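(* Let $F$ be a non-Riemannian Finsler metric on a manifold $M$ of dimension $n>2$. If $F$ is a $GDW$ metric and its Landsberg curvature vanishes, then $F$ is R-quadratic.
   Context: Finsler metric: a nonnegative function $F$ on $TM$, smooth on $TM_0=TM\setminus\{0\}$, with $F(\lambda y)=\lambda F(y)$ for $\lambda>0$, such that $g_{ij}(x,y)=\frac12\frac{\partial^2F^2}{\partial y^i\partial y^j}$ is positive definite on $TM_0$; $(g^{ij})$ is the inverse matrix and $y_i=g_{im}y^m$. $F$ is Riemannian if $g_{ij}$ does not depend on $y$. Einstein summation is used. All tensors are tensor fields along $TM_0$ (their components are functions of $(x,y)$, $y\neq0$). Spray coefficients: $G^i=\frac14 g^{il}\left\{\frac{\partial^2F^2}{\partial x^k\partial y^l}y^k-\frac{\partial F^2}{\partial x^l}\right\}$; $G^i_j=\frac{\partial G^i}{\partial y^j}$, $G^i_{jk}=\frac{\partial^2G^i}{\partial y^j\partial y^k}$. Horizontal covariant derivative of the Berwald connection, denoted $\mid$: with $\frac{\delta}{\delta x^m}=\frac{\partial}{\partial x^m}-G^r_m\frac{\partial}{\partial y^r}$, $T_j{}^i{}_{\mid m}=\frac{\delta T_j{}^i}{\delta x^m}+T_j{}^rG^i_{rm}-T_r{}^iG^r_{jm}$, and analogously for tensors with more indices. Berwald curvature: $B_j{}^i{}_{kl}=\frac{\partial^3G^i}{\partial y^j\partial y^k\partial y^l}$. Landsberg curvature: $L_{jkl}=-\frac12 y_iB_j{}^i{}_{kl}$. Douglas tensor: $D_j{}^i{}_{kl}=B_j{}^i{}_{kl}-\frac1{n+1}\frac{\partial^3}{\partial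 y^j\partial y^k\partial y^l}\left(\frac{\partial G^m}{\partial y^m}y^i\right)$. $GDW$ (generalized Douglas–Weyl) metric: $D_j{}^i{}_{kl\mid m}y^m=T_{jkl}y^i$ for some tensor $T_{jkl}$. Riemann curvature: $R^i{}_k=2\frac{\partial G^i}{\partial x^k}-y^j\frac{\partial^2G^i}{\partial x^j\partial y^k}+2G^j\frac{\partial^2G^i}{\partial y^j\partial y^k}-\frac{\partial G^i}{\partial y^j}\frac{\partial G^j}{\partial y^k}$. $F$ is R-quadratic if $R^i{}_k$ is quadratic in $y\in T_xM$ for every $x$; equivalently, $R_j{}^i{}_{kl}=\frac13\frac{\partial}{\partial y^j}\left(\frac{\partial R^i{}_k}{\partial y^l}-\frac{\partial R^i{}_l}{\partial y^k}\right)$ does not depend on $y$. *)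

theory Defs
  imports "HOL-Analysis.Analysis"
begin

section \<open>Smooth maps\<close>

text \<open>\<open>higher_differentiable_on S f k\<close> means that \<open>f\<close> is of class \<open>C\<^sup>k\<close> on \<open>S\<close>; it is used for open
  \<open>S\<close> only.\<close>

primrec higher_differentiable_on ::
    "'a::real_normed_vector set \<Rightarrow> ('a \<Rightarrow> 'b::real_normed_vector) \<Rightarrow> nat \<Rightarrow> bool" where
  "higher_differentiable_on S f 0 \<longleftrightarrow> continuous_on S f"
| "higher_differentiable_on S f (Suc k) \<longleftrightarrow>
     (\<forall>x\<in>S. f differentiable (at x)) \<and>
     (\<forall>v. higher_differentiable_on S (\<lambda>x. frechet_derivative f (at x) v) k)"

definition smooth_on :: "'a::real_normed_vector set \<Rightarrow> ('a \<Rightarrow> 'b::real_normed_vector) \<Rightarrow> bool" where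
  "smooth_on S f \<longleftrightarrow> (\<forall>k. higher_differentiable_on S f k)"


section \<open>Smooth manifolds and tangent vectors\<close>

text \<open>A chart is a coordinate domain together with a coordinate map; the values of the map outside
  the domain are irrelevant.\<close>

type_synonym ('a, 'n) chart = "'a set \<times> ('a \<Rightarrow> real ^ 'n)"

definition is_chart :: "'a topology \<Rightarrow> ('a, 'n::finite) chart \<Rightarrow> bool" where
  "is_chart X c \<longleftrightarrow> openin X (fst c) \<and> open (snd c ` fst c) \<and>
     homeomorphic_map (subtopology X (fst c)) (top_of_set (snd c ` fst c)) (snd c)"

definition chart_inv :: "('a, 'n) chart \<Rightarrow> real ^ 'n \<Rightarrow> 'a" where
  "chart_inv c = inv_into (fst c) (snd c)"

definition transition :: "('a, 'n) chart \<Rightarrow> ('a, 'n) chart \<Rightarrow> real ^ 'n \<Rightarrow> real ^ 'n" where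
  "transition c c' = (\<lambda>x. snd c' (chart_inv c x))"

definition smooth_atlas :: "'a topology \<Rightarrow> ('a, 'n::finite) chart set \<Rightarrow> bool" where
  "smooth_atlas X \<A> \<longleftrightarrow> (\<forall>c\<in>\<A>. is_chart X c) \<and> (\<Union>c\<in>\<A>. fst c) = topspace X \<and>
     (\<forall>c\<in>\<A>. \<forall>c'\<in>\<A>. smooth_on (snd c ` (fst c \<inter> fst c')) (transition c c'))"

definition smooth_manifold :: "'a topology \<Rightarrow> ('a, 'n::finite) chart set \<Rightarrow> bool" where
  "smooth_manifold X \<A> \<longleftrightarrow> Hausdorff_space X \<and> second_countable X \<and> smooth_atlas X \<A>"

text \<open>A tangent vector at \<open>p\<close> is the family of its component vectors in all charts around \<open>p\<close>, where the
  components in two charts are related by the Jacobian of the transition map; the value at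
  every other argument is set to 0.\<close>

type_synonym ('a, 'n) tangent_vector = "('a, 'n) chart \<Rightarrow> real ^ 'n"

definition tangent_space ::
    "('a, 'n::finite) chart set \<Rightarrow> 'a \<Rightarrow> ('a, 'n) tangent_vector set" where
  "tangent_space \<A> p = {v.
     (\<forall>c. \<not> (c \<in> \<A> \<and> p \<in> fst c) \<longrightarrow> v c = 0) \<and>
     (\<forall>c\<in>\<A>. \<forall>c'\<in>\<A>. p \<in> fst c \<longrightarrow> p \<in> fst c' \<longrightarrow>
        v c' = frechet_derivative (transition c c') (at (snd c p)) (v c))}"

text \<open>The tangent vector at \<open>p\<close> with components \<open>y\<close> in the chart \<open>c\<close>.\<close>

definition tangent_of ::
    "('a, 'n::finite) chart set \<Rightarrow> ('a, 'n) chart \<Rightarrow> 'a \<Rightarrow> real ^ 'n \<Rightarrow> ('a, 'n) tangent_vector" where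
  "tangent_of \<A> c p y = (\<lambda>c'. if c' \<in> \<A> \<and> p \<in> fst c'
     then frechet_derivative (transition c c') (at (snd c p)) y else 0)"

text \<open>A function \<open>F\<close> on the tangent bundle takes a point and a tangent vector at that point; its
  expression in the induced coordinates \<open>(x, y)\<close> of a chart is the following.\<close>

definition coord_expr ::
    "('a, 'n::finite) chart set \<Rightarrow> ('a \<Rightarrow> ('a, 'n) tangent_vector \<Rightarrow> real) \<Rightarrow> ('a, 'n) chart \<Rightarrow>
     real ^ 'n \<Rightarrow> real ^ 'n \<Rightarrow> real" where
  "coord_expr \<A> F c = (\<lambda>x y. F (chart_inv c x) (tangent_of \<A> c (chart_inv c x) y))"


section \<open>Coordinate formulas of Finsler geometry\<close>

definition partial :: "'n::finite \<Rightarrow> (real ^ 'n \<Rightarrow> real) \<Rightarrow> real ^ 'n \<Rightarrow> real" where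
  "partial i f x = deriv (\<lambda>t. f (x + t *\<^sub>R axis i 1)) 0"

type_synonym 'n coord_fun = "real ^ 'n \<Rightarrow> real ^ 'n \<Rightarrow> real"

text \<open>\<open>dx i\<close> is \<open>\<partial>/\<partial>x\<^sup>i\<close> and \<open>dy i\<close> is \<open>\<partial>/\<partial>y\<^sup>i\<close>. Throughout this section \<open>L\<close> is the expression of
  the Finsler metric in a chart, and the indices of a tensor occur in the usual order:
  \<open>D_j\<^sup>i_k_l\<close> is written \<open>D j i k l\<close>.\<close>

definition dx :: "'n::finite \<Rightarrow> 'n coord_fun \<Rightarrow> 'n coord_fun" where
  "dx i f = (\<lambda>x y. partial i (\<lambda>x'. f x' y) x)"

definition dy :: "'n::finite \<Rightarrow> 'n coord_fun \<Rightarrow> 'n coord_fun" where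
  "dy i f = (\<lambda>x y. partial i (f x) y)"

definition sq :: "'n coord_fun \<Rightarrow> 'n coord_fun" where
  "sq L = (\<lambda>x y. (L x y)\<^sup>2)"

definition fund_tensor :: "'n::finite coord_fun \<Rightarrow> 'n \<Rightarrow> 'n \<Rightarrow> 'n coord_fun" where
  "fund_tensor L i j = (\<lambda>x y. 1/2 * dy i (dy j (sq L)) x y)"

definition fund_tensor_inv :: "'n::finite coord_fun \<Rightarrow> 'n \<Rightarrow> 'n \<Rightarrow> 'n coord_fun" where
  "fund_tensor_inv L i j = (\<lambda>x y. matrix_inv (\<chi> a b. fund_tensor L a b x y) $ i $ j)"

definition y_low :: "'n::finite coord_fun \<Rightarrow> 'n \<Rightarrow> 'n coord_fun" where
  "y_low L i = (\<lambda>x y. \<Sum>m\<in>UNIV. fund_tensor L i m x y * y $ m)"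

definition spray :: "'n::finite coord_fun \<Rightarrow> 'n \<Rightarrow> 'n coord_fun" where
  "spray L i = (\<lambda>x y. 1/4 * (\<Sum>l\<in>UNIV. fund_tensor_inv L i l x y *
     ((\<Sum>k\<in>UNIV. dx k (dy l (sq L)) x y * y $ k) - dx l (sq L) x y)))"

definition spray1 :: "'n::finite coord_fun \<Rightarrow> 'n \<Rightarrow> 'n \<Rightarrow> 'n coord_fun" where
  "spray1 L i j = dy j (spray L i)"

definition spray2 :: "'n::finite coord_fun \<Rightarrow> 'n \<Rightarrow> 'n \<Rightarrow> 'n \<Rightarrow> 'n coord_fun" where
  "spray2 L i j k = dy j (dy k (spray L i))"

definition hdelta :: "'n::finite coord_fun \<Rightarrow> 'n \<Rightarrow> 'n coord_fun \<Rightarrow> 'n coord_fun" where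
  "hdelta L m f = (\<lambda>x y. dx m f x y - (\<Sum>r\<in>UNIV. spray1 L r m x y * dy r f x y))"

text \<open>Horizontal covariant derivative (Berwald connection) of a tensor \<open>D_j\<^sup>i_k_l\<close>.\<close>

definition hcov13 :: "'n::finite coord_fun \<Rightarrow> ('n \<Rightarrow> 'n \<Rightarrow> 'n \<Rightarrow> 'n \<Rightarrow> 'n coord_fun) \<Rightarrow>
    'n \<Rightarrow> 'n \<Rightarrow> 'n \<Rightarrow> 'n \<Rightarrow> 'n \<Rightarrow> 'n coord_fun" where
  "hcov13 L D j i k l m = (\<lambda>x y. hdelta L m (D j i k l) x y
     + (\<Sum>r\<in>UNIV. D j r k l x y * spray2 L i r m x y)
     - (\<Sum>r\<in>UNIV. D r i k l x y * spray2 L r j m x y)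
     - (\<Sum>r\<in>UNIV. D j i r l x y * spray2 L r k m x y)
     - (\<Sum>r\<in>UNIV. D j i k r x y * spray2 L r l m x y))"

definition berwald :: "'n::finite coord_fun \<Rightarrow> 'n \<Rightarrow> 'n \<Rightarrow> 'n \<Rightarrow> 'n \<Rightarrow> 'n coord_fun" where
  "berwald L j i k l = dy j (dy k (dy l (spray L i)))"

definition landsberg :: "'n::finite coord_fun \<Rightarrow> 'n \<Rightarrow> 'n \<Rightarrow> 'n \<Rightarrow> 'n coord_fun" where
  "landsberg L j k l = (\<lambda>x y. - 1/2 * (\<Sum>i\<in>UNIV. y_low L i x y * berwald L j i k l x y))"

definition douglas :: "'n::finite coord_fun \<Rightarrow> 'n \<Rightarrow> 'n \<Rightarrow> 'n \<Rightarrow> 'n \<Rightarrow> 'n coord_fun" where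
  "douglas L j i k l = (\<lambda>x y. berwald L j i k l x y - 1 / (real CARD('n) + 1) *
     dy j (dy k (dy l (\<lambda>x y. (\<Sum>m\<in>UNIV. spray1 L m m x y) * y $ i))) x y)"

definition riemann :: "'n::finite coord_fun \<Rightarrow> 'n \<Rightarrow> 'n \<Rightarrow> 'n coord_fun" where
  "riemann L i k = (\<lambda>x y. 2 * dx k (spray L i) x y
     - (\<Sum>j\<in>UNIV. y $ j * dx j (dy k (spray L i)) x y)
     + 2 * (\<Sum>j\<in>UNIV. spray L j x y * dy j (dy k (spray L i)) x y)
     - (\<Sum>j\<in>UNIV. dy j (spray L i) x y * dy k (spray L j) x y))"


section \<open>Finsler metrics on a manifold\<close>

definition finsler_metric :: "'a topology \<Rightarrow> ('a, 'n::finite) chart set \<Rightarrow>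
    ('a \<Rightarrow> ('a, 'n) tangent_vector \<Rightarrow> real) \<Rightarrow> bool" where
  "finsler_metric X \<A> F \<longleftrightarrow>
     (\<forall>p\<in>topspace X. \<forall>v\<in>tangent_space \<A> p. F p v \<ge> 0) \<and>
     (\<forall>p\<in>topspace X. \<forall>v\<in>tangent_space \<A> p. \<forall>a>0. F p (\<lambda>c. a *\<^sub>R v c) = a * F p v) \<and>
     (\<forall>c\<in>\<A>. smooth_on ((snd c ` fst c) \<times> (- {0})) (\<lambda>(x, y). coord_expr \<A> F c x y)) \<and>
     (\<forall>c\<in>\<A>. \<forall>x\<in>snd c ` fst c. \<forall>y. y \<noteq> 0 \<longrightarrow> (\<forall>u::real ^ 'n. u \<noteq> 0 \<longrightarrow>
        (\<Sum>i\<in>UNIV. \<Sum>j\<in>UNIV. fund_tensor (coord_expr \<A> F c) i j x y * u $ i * u $ j) > 0))"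

definition riemannian :: "('a, 'n::finite) chart set \<Rightarrow>
    ('a \<Rightarrow> ('a, 'n) tangent_vector \<Rightarrow> real) \<Rightarrow> bool" where
  "riemannian \<A> F \<longleftrightarrow> (\<forall>c\<in>\<A>. \<forall>x\<in>snd c ` fst c. \<forall>i j. \<forall>y y'. y \<noteq> 0 \<longrightarrow> y' \<noteq> 0 \<longrightarrow>
     fund_tensor (coord_expr \<A> F c) i j x y = fund_tensor (coord_expr \<A> F c) i j x y')"

text \<open>A covariant tensor field of rank 3 along the slit tangent bundle, given by its components
  \<open>T c j k l x y\<close> in every chart \<open>c\<close>.\<close>

definition tensor_field03 :: "('a, 'n::finite) chart set \<Rightarrow>
    (('a, 'n) chart \<Rightarrow> 'n \<Rightarrow> 'n \<Rightarrow> 'n \<Rightarrow> 'n coord_fun) \<Rightarrow> bool" where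
  "tensor_field03 \<A> T \<longleftrightarrow> (\<forall>c\<in>\<A>. \<forall>c'\<in>\<A>. \<forall>x\<in>snd c ` (fst c \<inter> fst c'). \<forall>y. y \<noteq> 0 \<longrightarrow>
     (let J = frechet_derivative (transition c c') (at x) in
       \<forall>j k l. T c j k l x y = (\<Sum>a\<in>UNIV. \<Sum>b\<in>UNIV. \<Sum>d\<in>UNIV.
         T c' a b d (transition c c' x) (J y) *
         J (axis j 1) $ a * J (axis k 1) $ b * J (axis l 1) $ d)))"

definition GDW :: "('a, 'n::finite) chart set \<Rightarrow>
    ('a \<Rightarrow> ('a, 'n) tangent_vector \<Rightarrow> real) \<Rightarrow> bool" where
  "GDW \<A> F \<longleftrightarrow> (\<exists>T. tensor_field03 \<A> T \<and>
     (\<forall>c\<in>\<A>. \<forall>x\<in>snd c ` fst c. \<forall>y. y \<noteq> 0 \<longrightarrow> (\<forall>i j k l.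
        (\<Sum>m\<in>UNIV. hcov13 (coord_expr \<A> F c) (douglas (coord_expr \<A> F c)) j i k l m x y * y $ m)
          = T c j k l x y * y $ i)))"

definition landsberg_vanishes :: "('a, 'n::finite) chart set \<Rightarrow>
    ('a \<Rightarrow> ('a, 'n) tangent_vector \<Rightarrow> real) \<Rightarrow> bool" where
  "landsberg_vanishes \<A> F \<longleftrightarrow> (\<forall>c\<in>\<A>. \<forall>x\<in>snd c ` fst c. \<forall>y. y \<noteq> 0 \<longrightarrow>
     (\<forall>j k l. landsberg (coord_expr \<A> F c) j k l x y = 0))"

definition R_quadratic :: "('a, 'n::finite) chart set \<Rightarrow>
    ('a \<Rightarrow> ('a, 'n) tangent_vector \<Rightarrow> real) \<Rightarrow> bool" where
  "R_quadratic \<A> F \<longleftrightarrow> (\<forall>c\<in>\<A>. \<forall>x\<in>snd c ` fst c. \<forall>i k. \<exists>q :: 'n \<Rightarrow> 'n \<Rightarrow> real.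
     \<forall>y. y \<noteq> 0 \<longrightarrow>
       riemann (coord_expr \<A> F c) i k x y = (\<Sum>a\<in>UNIV. \<Sum>b\<in>UNIV. q a b * y $ a * y $ b))"

end

theory Submission
  imports Defs
begin

text \<open>
  Everything happens in one chart, on functions of \<open>(x, y)\<close> with \<open>y \<noteq> 0\<close>. Let \<open>\<nabla>\<close> be the horizontal
  covariant derivative along \<open>y\<close> and \<open>M = \<nabla>B\<close>, with \<open>B\<close> the Berwald curvature. A direct computation
  expresses the third vertical derivatives of \<open>R\<^sup>i\<^sub>k\<close> through the first vertical derivatives of \<open>M\<close>, so it
  suffices to show \<open>M = 0\<close>.

  If the Landsberg curvature vanishes, then \<open>B\<close> with its upper index lowered is totally symmetric, and so
  is \<open>M\<close> because \<open>\<nabla>g = 0\<close>. The GDW equation gives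
  \<open>M\<^sub>m\<^sub>j\<^sub>k\<^sub>l = E\<^sub>j\<^sub>k h\<^sub>l\<^sub>m + E\<^sub>k\<^sub>l h\<^sub>j\<^sub>m + E\<^sub>l\<^sub>j h\<^sub>k\<^sub>m\<close> with \<open>h\<close> the angular metric and \<open>E\<close> the
  \<open>\<nabla>\<close>-derivative of the mean Berwald curvature, and symmetry forces \<open>E = \<lambda> h\<close>.

  Let \<open>C\<close> be the Cartan tensor. Vertical differentiation of the lowered \<open>B\<close> shows that
  \<open>C\<^sub>i\<^sub>m\<^sub>l B\<^sup>i\<^sub>j\<^sub>s\<^sub>k - C\<^sub>i\<^sub>m\<^sub>k B\<^sup>i\<^sub>j\<^sub>s\<^sub>l\<close> is symmetric in \<open>m, j\<close>; applying \<open>\<nabla>\<close>, where \<open>\<nabla>C = 0\<close>, the same holds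
  for \<open>M\<close> instead of \<open>B\<close>. Contracting twice yields \<open>(n - 2) \<lambda> I = 0\<close> for the mean Cartan torsion \<open>I\<close>.
  For a Landsberg metric the mean Berwald curvature is a horizontal derivative of \<open>I\<close>, so it vanishes
  wherever \<open>\<lambda> \<noteq> 0\<close>, and then so does its \<open>\<nabla>\<close>-derivative \<open>\<lambda> h\<close>. Hence \<open>\<lambda> = 0\<close> and \<open>M = 0\<close>.
\<close>

section \<open>Smooth real functions\<close>

lemma higher_differentiable_on_cong:
  assumes "open S" "\<And>x. x \<in> S \<Longrightarrow> f x = g x" "higher_differentiable_on S f k"
  shows "higher_differentiable_on S g k"
  using assms(2,3)
proof (induction k arbitrary: f g)
  case 0
  then show ?case by (simp cong: continuous_on_cong)
next
  case (Suc k)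
  have eq: "frechet_derivative f (at x) = frechet_derivative g (at x)" if "x \<in> S" for x
    using frechet_derivative_transform_within_open[of f x S g] Suc.prems(1)[OF that] Suc.prems assms(1) that
    by simp
  have "g differentiable (at x)" if "x \<in> S" for x
    using has_derivative_transform_within_open[OF _ assms(1) that, of f _ UNIV g] Suc.prems that
    unfolding differentiable_def by (metis higher_differentiable_on.simps(2) differentiable_def)
  moreover have "higher_differentiable_on S (\<lambda>x. frechet_derivative g (at x) v) k" for v
    by (rule Suc.IH[of "\<lambda>x. frechet_derivative f (at x) v"]) (use Suc.prems eq in auto)
  ultimately show ?case by simp
qed

lemma higher_differentiable_on_SucD:
  "higher_differentiable_on S f (Suc k) \<Longrightarrow> higher_differentiable_on S f k"
proof (induction k arbitrary: f)
  case 0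
  then show ?case
    by (auto intro!: continuous_at_imp_continuous_on differentiable_imp_continuous_within)
next
  case (Suc k)
  then show ?case by (metis higher_differentiable_on.simps(2))
qed

lemma higher_differentiable_on_const: "higher_differentiable_on S (\<lambda>x. c) k"
  by (induction k arbitrary: c) auto

lemma frechet_derivative_eqI: "(f has_derivative f') (at x) \<Longrightarrow> frechet_derivative f (at x) = f'"
  by (metis frechet_derivative_at)

lemma higher_differentiable_on_bounded_linear:
  assumes "bounded_linear f"
  shows "higher_differentiable_on S f k"
proof (cases k)
  case 0
  then show ?thesis using assms by (simp add: linear_continuous_on)
next
  case (Suc m)
  have "frechet_derivative f (at x) = f" for x
    by (intro frechet_derivative_eqI bounded_linear_imp_has_derivative assms)
  then show ?thesis
    using Suc assms higher_differentiable_on_const bounded_linear_imp_differentiable by auto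
qed

lemma higher_differentiable_on_add:
  assumes "open S" "higher_differentiable_on S f k" "higher_differentiable_on S g k"
  shows "higher_differentiable_on S (\<lambda>x. f x + g x) k"
  using assms(2,3)
proof (induction k arbitrary: f g)
  case 0
  then show ?case by (simp add: continuous_on_add)
next
  case (Suc k)
  have eq: "frechet_derivative (\<lambda>x. f x + g x) (at x) =
      (\<lambda>v. frechet_derivative f (at x) v + frechet_derivative g (at x) v)" if "x \<in> S" for x
    using Suc.prems that
    by (intro frechet_derivative_eqI has_derivative_add) (auto simp: frechet_derivative_works)
  have "higher_differentiable_on S
      (\<lambda>x. frechet_derivative f (at x) v + frechet_derivative g (at x) v) k" for v
    by (rule Suc.IH) (use Suc.prems in auto)
  then have "higher_differentiable_on S (\<lambda>x. frechet_derivative (\<lambda>x. f x + g x) (at x) v) k" for v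
    by (rule higher_differentiable_on_cong[OF assms(1), rotated]) (simp add: eq)
  then show ?case
    using Suc.prems by (auto intro!: differentiable_add)
qed

lemma higher_differentiable_on_mult:
  fixes f g :: "'a::real_normed_vector \<Rightarrow> real"
  assumes "open S" "higher_differentiable_on S f k" "higher_differentiable_on S g k"
  shows "higher_differentiable_on S (\<lambda>x. f x * g x) k"
  using assms(2,3)
proof (induction k arbitrary: f g)
  case 0
  then show ?case by (simp add: continuous_on_mult)
next
  case (Suc k)
  have eq: "frechet_derivative (\<lambda>x. f x * g x) (at x) =
      (\<lambda>v. f x * frechet_derivative g (at x) v + frechet_derivative f (at x) v * g x)" if "x \<in> S" for x
    using Suc.prems that
    by (intro frechet_derivative_eqI has_derivative_mult) (auto simp: frechet_derivative_works)
  have "higher_differentiable_on S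
      (\<lambda>x. f x * frechet_derivative g (at x) v + frechet_derivative f (at x) v * g x) k" for v
    using Suc.prems higher_differentiable_on_SucD[OF Suc.prems(1)] higher_differentiable_on_SucD[OF Suc.prems(2)]
    by (intro higher_differentiable_on_add assms(1) Suc.IH) auto
  then have "higher_differentiable_on S (\<lambda>x. frechet_derivative (\<lambda>x. f x * g x) (at x) v) k" for v
    by (rule higher_differentiable_on_cong[OF assms(1), rotated]) (simp add: eq)
  then show ?case
    using Suc.prems by (auto intro!: differentiable_mult)
qed

text \<open>The derivative of \<open>1/f\<close> is \<open>- (1/f) f' (1/f)\<close>, so regularity
  of \<open>1/f\<close> at one order and the product rule give the next order, with \<open>f\<close>
  fixed throughout the induction.\<close>

lemma higher_differentiable_on_inverse:
  fixes f :: "'a::real_normed_vector \<Rightarrow> real"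
  assumes "open S" "\<And>x. x \<in> S \<Longrightarrow> f x \<noteq> 0" "higher_differentiable_on S f k"
  shows "higher_differentiable_on S (\<lambda>x. inverse (f x)) k"
  using assms(3)
proof (induction k)
  case 0
  then show ?case using assms(2) by (simp add: continuous_on_inverse)
next
  case (Suc k)
  have d: "((\<lambda>x. inverse (f x)) has_derivative
      (\<lambda>v. - (inverse (f x) * frechet_derivative f (at x) v * inverse (f x)))) (at x)" if "x \<in> S" for x
    using Suc.prems that assms(2)
    by (intro Deriv.has_derivative_inverse) (auto simp: frechet_derivative_works)
  have "higher_differentiable_on S (\<lambda>x. inverse (f x)) k"
    using Suc higher_differentiable_on_SucD by blast
  then have "higher_differentiable_on S
      (\<lambda>x. (-1) * (inverse (f x) * frechet_derivative f (at x) v * inverse (f x))) k" for v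
    using Suc.prems
    by (intro higher_differentiable_on_mult higher_differentiable_on_const assms(1)) auto
  then have "higher_differentiable_on S (\<lambda>x. frechet_derivative (\<lambda>x. inverse (f x)) (at x) v) k" for v
    by (rule higher_differentiable_on_cong[OF assms(1), rotated, of "\<lambda>x. (-1) *
        (inverse (f x) * frechet_derivative f (at x) v * inverse (f x))"])
      (simp_all add: frechet_derivative_eqI[OF d])
  then show ?case
    using d by (auto simp: differentiable_def)
qed

lemma smooth_on_differentiable: "smooth_on S f \<Longrightarrow> x \<in> S \<Longrightarrow> f differentiable (at x)"
  unfolding smooth_on_def by (metis higher_differentiable_on.simps(2))

lemma smooth_on_has_derivative:
  "smooth_on S f \<Longrightarrow> x \<in> S \<Longrightarrow> (f has_derivative frechet_derivative f (at x)) (at x)"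
  using smooth_on_differentiable frechet_derivative_works by blast

lemma smooth_on_continuous: "smooth_on S f \<Longrightarrow> continuous_on S f"
  unfolding smooth_on_def by (metis higher_differentiable_on.simps(1))

lemma smooth_on_frechet_derivative:
  "smooth_on S f \<Longrightarrow> smooth_on S (\<lambda>x. frechet_derivative f (at x) v)"
  unfolding smooth_on_def by (metis higher_differentiable_on.simps(2))

text \<open>Mean value theorem twice: first along \<open>u\<close> for the difference of
  \<open>f\<close> across \<open>t v\<close>, then along \<open>v\<close> for the derivative in
  direction \<open>u\<close>.\<close>

lemma second_difference_MVT:
  fixes f :: "'a::real_normed_vector \<Rightarrow> real"
  assumes sm: "smooth_on S f" and t: "t > 0"
    and S: "\<And>a b. 0 \<le> a \<Longrightarrow> a \<le> t \<Longrightarrow> 0 \<le> b \<Longrightarrow> b \<le> t \<Longrightarrow> x + a *\<^sub>R u + b *\<^sub>R v \<in> S"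
  shows "\<exists>a b. 0 < a \<and> a < t \<and> 0 < b \<and> b < t \<and>
    f (x + t *\<^sub>R u + t *\<^sub>R v) - f (x + t *\<^sub>R u) - f (x + t *\<^sub>R v) + f x =
    t * t * frechet_derivative (\<lambda>z. frechet_derivative f (at z) u) (at (x + a *\<^sub>R u + b *\<^sub>R v)) v"
proof -
  let ?g = "\<lambda>z. frechet_derivative f (at z) u"
  have d1: "((\<lambda>a. f (x + a *\<^sub>R u + b *\<^sub>R v)) has_real_derivative ?g (x + a *\<^sub>R u + b *\<^sub>R v)) (at a)"
    if "0 \<le> a" "a \<le> t" "0 \<le> b" "b \<le> t" for a b
  proof -
    have "((\<lambda>a. x + a *\<^sub>R u + b *\<^sub>R v) has_derivative (\<lambda>h. h *\<^sub>R u)) (at a)"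
      by (auto intro!: derivative_eq_intros)
    from has_derivative_compose[OF this smooth_on_has_derivative[OF sm S[OF that]]]
    have "((\<lambda>a. f (x + a *\<^sub>R u + b *\<^sub>R v)) has_derivative
       (\<lambda>h. frechet_derivative f (at (x + a *\<^sub>R u + b *\<^sub>R v)) (h *\<^sub>R u))) (at a)" .
    moreover have "frechet_derivative f (at (x + a *\<^sub>R u + b *\<^sub>R v)) (h *\<^sub>R u)
        = ?g (x + a *\<^sub>R u + b *\<^sub>R v) * h" for h
      using linear_frechet_derivative[OF smooth_on_differentiable[OF sm S[OF that]]]
      by (simp add: linear_cmul)
    ultimately show ?thesis by (simp add: has_field_derivative_def)
  qed
  have d2: "((\<lambda>b. ?g (x + a *\<^sub>R u + b *\<^sub>R v)) has_real_derivative
      frechet_derivative ?g (at (x + a *\<^sub>R u + b *\<^sub>R v)) v) (at b)"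
    if "0 \<le> a" "a \<le> t" "0 \<le> b" "b \<le> t" for a b
  proof -
    have sg: "smooth_on S ?g" by (rule smooth_on_frechet_derivative[OF sm])
    have "((\<lambda>b. x + a *\<^sub>R u + b *\<^sub>R v) has_derivative (\<lambda>h. h *\<^sub>R v)) (at b)"
      by (auto intro!: derivative_eq_intros)
    from has_derivative_compose[OF this smooth_on_has_derivative[OF sg S[OF that]]]
    have "((\<lambda>b. ?g (x + a *\<^sub>R u + b *\<^sub>R v)) has_derivative
       (\<lambda>h. frechet_derivative ?g (at (x + a *\<^sub>R u + b *\<^sub>R v)) (h *\<^sub>R v))) (at b)" .
    moreover have "frechet_derivative ?g (at (x + a *\<^sub>R u + b *\<^sub>R v)) (h *\<^sub>R v)
        = frechet_derivative ?g (at (x + a *\<^sub>R u + b *\<^sub>R v)) v * h" for h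
      using linear_frechet_derivative[OF smooth_on_differentiable[OF sg S[OF that]]]
      by (simp add: linear_cmul)
    ultimately show ?thesis by (simp add: has_field_derivative_def)
  qed
  have "\<exists>a. a > 0 \<and> a < t \<and>
      (f (x + t *\<^sub>R u + t *\<^sub>R v) - f (x + t *\<^sub>R u + 0 *\<^sub>R v)) -
      (f (x + 0 *\<^sub>R u + t *\<^sub>R v) - f (x + 0 *\<^sub>R u + 0 *\<^sub>R v)) =
      (t - 0) * (?g (x + a *\<^sub>R u + t *\<^sub>R v) - ?g (x + a *\<^sub>R u + 0 *\<^sub>R v))"
    using t d1 by (intro MVT2[OF t, of "\<lambda>a. f (x + a *\<^sub>R u + t *\<^sub>R v) - f (x + a *\<^sub>R u + 0 *\<^sub>R v)"])
      (auto intro!: DERIV_diff simp del: scale_zero_left add_0_right)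
  then obtain a where a: "a > 0" "a < t" and e1: "f (x + t *\<^sub>R u + t *\<^sub>R v) - f (x + t *\<^sub>R u)
      - f (x + t *\<^sub>R v) + f x = t * (?g (x + a *\<^sub>R u + t *\<^sub>R v) - ?g (x + a *\<^sub>R u + 0 *\<^sub>R v))"
    by (auto simp: algebra_simps)
  have "\<exists>b. b > 0 \<and> b < t \<and> ?g (x + a *\<^sub>R u + t *\<^sub>R v) - ?g (x + a *\<^sub>R u + 0 *\<^sub>R v) =
      (t - 0) * frechet_derivative ?g (at (x + a *\<^sub>R u + b *\<^sub>R v)) v"
    using t a d2 by (intro MVT2[OF t, of "\<lambda>b. ?g (x + a *\<^sub>R u + b *\<^sub>R v)"]) auto
  then show ?thesis using a e1 by force
qed

text \<open>The second difference over the parallelogram spanned by \<open>t u\<close> and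
  \<open>t v\<close> is symmetric in \<open>u\<close>, \<open>v\<close>, and is \<open>t * t\<close>
  times either mixed derivative at some nearby point. Continuity of the two mixed derivatives then
  rules out a gap at \<open>x\<close>.\<close>

lemma second_derivative_symmetric:
  fixes f :: "'a::real_normed_vector \<Rightarrow> real"
  assumes op: "open S" and sm: "smooth_on S f" and x: "x \<in> S"
  shows "frechet_derivative (\<lambda>z. frechet_derivative f (at z) u) (at x) v =
    frechet_derivative (\<lambda>z. frechet_derivative f (at z) v) (at x) u"
proof (rule ccontr)
  let ?A = "\<lambda>u v z. frechet_derivative (\<lambda>z. frechet_derivative f (at z) u) (at z) v"
  assume ne: "?A u v x \<noteq> ?A v u x"
  define e where "e = \<bar>?A u v x - ?A v u x\<bar> / 2"
  have e: "e > 0" using ne by (simp add: e_def)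
  have cont: "continuous (at x) (?A u v)" for u v
    using smooth_on_continuous[OF smooth_on_frechet_derivative[OF smooth_on_frechet_derivative[OF sm]]]
      op x continuous_on_eq_continuous_at by blast
  obtain d1 where d1: "d1 > 0" "\<And>z. dist z x < d1 \<Longrightarrow> dist (?A u v z) (?A u v x) < e"
    using cont[of u v] e unfolding continuous_at_eps_delta by blast
  obtain d2 where d2: "d2 > 0" "\<And>z. dist z x < d2 \<Longrightarrow> dist (?A v u z) (?A v u x) < e"
    using cont[of v u] e unfolding continuous_at_eps_delta by blast
  obtain d3 where d3: "d3 > 0" "ball x d3 \<subseteq> S" using op x openE by blast
  define d where "d = min d1 (min d2 d3)"
  \<comment> \<open>Small enough for the parallelogram to stay within distance \<open>d\<close> of
    \<open>x\<close>; the summand 1 keeps the denominator positive when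
    \<open>u = v = 0\<close>.\<close>
  define t where "t = d / (norm u + norm v + 1) / 2"
  have pos: "norm u + norm v + 1 > 0" by (smt (verit) norm_ge_zero)
  have dpos: "d > 0" using d1 d2 d3 by (simp add: d_def)
  have t: "t > 0" using dpos pos by (simp add: t_def)
  have cancel: "d / N / 2 * N * 2 = d" if "N > 0" for N using that by simp
  have tt: "t * (norm u + norm v) < d"
  proof -
    have "t * (norm u + norm v) < t * (norm u + norm v + 1) * 2" using t
      by (simp add: algebra_simps) (smt (verit) mult_nonneg_nonneg norm_ge_zero)
    also have "\<dots> = d" unfolding t_def using cancel[OF pos] .
    finally show ?thesis .
  qed
  have cl: "dist (x + a *\<^sub>R u + b *\<^sub>R v) x < d" if "0 \<le> a" "a \<le> t" "0 \<le> b" "b \<le> t" for a b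
  proof -
    have "norm (a *\<^sub>R u + b *\<^sub>R v) \<le> a * norm u + b * norm v"
      using norm_triangle_ineq[of "a *\<^sub>R u" "b *\<^sub>R v"] that by simp
    also have "\<dots> \<le> t * norm u + t * norm v" using that by (intro add_mono mult_right_mono) auto
    finally show ?thesis using tt by (simp add: dist_norm algebra_simps)
  qed
  have inS: "x + a *\<^sub>R u + b *\<^sub>R v \<in> S" if "0 \<le> a" "a \<le> t" "0 \<le> b" "b \<le> t" for a b
    using cl[OF that] d3 by (auto simp: d_def subset_eq dist_commute)
  have inS': "x + a *\<^sub>R v + b *\<^sub>R u \<in> S" if "0 \<le> a" "a \<le> t" "0 \<le> b" "b \<le> t" for a b
    using inS[of b a] that by (simp add: algebra_simps)
  obtain a b where ab: "0 < a" "a < t" "0 < b" "b < t"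
    "f (x + t *\<^sub>R u + t *\<^sub>R v) - f (x + t *\<^sub>R u) - f (x + t *\<^sub>R v) + f x
      = t * t * ?A u v (x + a *\<^sub>R u + b *\<^sub>R v)"
    using second_difference_MVT[OF sm t inS] by blast
  obtain a' b' where ab': "0 < a'" "a' < t" "0 < b'" "b' < t"
    "f (x + t *\<^sub>R v + t *\<^sub>R u) - f (x + t *\<^sub>R v) - f (x + t *\<^sub>R u) + f x
      = t * t * ?A v u (x + a' *\<^sub>R v + b' *\<^sub>R u)"
    using second_difference_MVT[OF sm t inS'] by blast
  have "t * t * ?A u v (x + a *\<^sub>R u + b *\<^sub>R v) = t * t * ?A v u (x + a' *\<^sub>R v + b' *\<^sub>R u)"
    using ab(5) ab'(5) by (simp add: algebra_simps)
  then have "?A u v (x + a *\<^sub>R u + b *\<^sub>R v) = ?A v u (x + a' *\<^sub>R v + b' *\<^sub>R u)"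
    using t by simp
  moreover have "dist (?A u v (x + a *\<^sub>R u + b *\<^sub>R v)) (?A u v x) < e"
    using cl[of a b] ab by (intro d1) (auto simp: d_def)
  moreover have "dist (?A v u (x + a' *\<^sub>R v + b' *\<^sub>R u)) (?A v u x) < e"
    using cl[of b' a'] ab' by (intro d2) (auto simp: d_def algebra_simps)
  ultimately show False unfolding e_def dist_real_def by (simp add: abs_if split: if_splits)
qed

section \<open>Calculus on the slit tangent bundle of a coordinate domain\<close>

definition smooth_expr :: "(real ^ 'n::finite) set \<Rightarrow> 'n coord_fun \<Rightarrow> bool" where
  "smooth_expr U f \<longleftrightarrow> smooth_on (U \<times> - {0}) (\<lambda>p. f (fst p) (snd p))"

text \<open>The partial derivatives \<open>dx i\<close> and \<open>dy i\<close> are the directions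
  \<open>(axis i 1, 0)\<close> and \<open>(0, axis i 1)\<close>, so the calculus rules are proved
  once and then specialised.\<close>

definition dir_deriv :: "(real ^ 'n::finite) \<times> (real ^ 'n) \<Rightarrow> 'n coord_fun \<Rightarrow> 'n coord_fun" where
  "dir_deriv e f = (\<lambda>x y. frechet_derivative (\<lambda>p. f (fst p) (snd p)) (at (x, y)) e)"

lemma open_slit: "open U \<Longrightarrow> open (U \<times> - {0::real ^ 'n::finite})"
  by (intro open_Times) auto

lemma smooth_expr_has_derivative:
  assumes "smooth_expr U f" "x \<in> U" "y \<noteq> 0"
  shows "((\<lambda>p. f (fst p) (snd p)) has_derivative (\<lambda>e. dir_deriv e f x y)) (at (x, y))"
  using assms smooth_on_has_derivative[of "U \<times> - {0}" "\<lambda>p. f (fst p) (snd p)" "(x, y)"]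
  by (auto simp: smooth_expr_def dir_deriv_def)

lemma has_derivative_dir_deriv:
  "((\<lambda>p. f (fst p) (snd p)) has_derivative D) (at (x, y)) \<Longrightarrow> dir_deriv e f x y = D e"
  unfolding dir_deriv_def by (simp add: frechet_derivative_eqI)

text \<open>Chain rule along a curve. Coordinate lines give the partial derivatives; rays
  \<open>t y\<close> and rescaled lines give the homogeneity statements.\<close>

lemma smooth_expr_curve:
  assumes "smooth_expr U f" "a t \<in> U" "b t \<noteq> 0"
    and "(a has_derivative (\<lambda>h. h *\<^sub>R a')) (at t)" "(b has_derivative (\<lambda>h. h *\<^sub>R b')) (at t)"
  shows "((\<lambda>t. f (a t) (b t)) has_real_derivative dir_deriv (a', b') f (a t) (b t)) (at t)"
proof -
  have D: "((\<lambda>p. f (fst p) (snd p)) has_derivative (\<lambda>e. dir_deriv e f (a t) (b t))) (at (a t, b t))"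
    by (rule smooth_expr_has_derivative) (use assms in auto)
  have "((\<lambda>t. (a t, b t)) has_derivative (\<lambda>h. (h *\<^sub>R a', h *\<^sub>R b'))) (at t)"
    by (intro has_derivative_Pair assms)
  from has_derivative_compose[OF this D]
  have "((\<lambda>t. f (a t) (b t)) has_derivative (\<lambda>h. dir_deriv (h *\<^sub>R (a', b')) f (a t) (b t))) (at t)"
    by simp
  moreover have "dir_deriv (h *\<^sub>R (a', b')) f (a t) (b t) = dir_deriv (a', b') f (a t) (b t) * h" for h
    using linear_cmul[OF has_derivative_linear[OF D], of h "(a', b')"] by simp
  ultimately show ?thesis by (simp add: has_field_derivative_def)
qed

lemma has_derivative_line: "((\<lambda>t. x + t *\<^sub>R v) has_derivative (\<lambda>h. h *\<^sub>R v)) (at t)"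
  by (auto intro!: derivative_eq_intros)

lemma dx_eq_dir_deriv:
  assumes "smooth_expr U f" "x \<in> U" "y \<noteq> 0"
  shows "dx i f x y = dir_deriv (axis i 1, 0) f x y"
  unfolding dx_def partial_def
  using smooth_expr_curve[OF assms(1), of "\<lambda>t. x + t *\<^sub>R axis i 1" 0 "\<lambda>t. y" "axis i 1" 0] assms
  by (intro DERIV_imp_deriv) (simp add: has_derivative_line)

lemma dy_eq_dir_deriv:
  assumes "smooth_expr U f" "x \<in> U" "y \<noteq> 0"
  shows "dy i f x y = dir_deriv (0, axis i 1) f x y"
  unfolding dy_def partial_def
  using smooth_expr_curve[OF assms(1), of "\<lambda>t. x" 0 "\<lambda>t. y + t *\<^sub>R axis i 1" 0 "axis i 1"] assms
  by (intro DERIV_imp_deriv) (simp add: has_derivative_line)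

lemma smooth_expr_cong:
  assumes "open U" "smooth_expr U f" "\<And>x y. x \<in> U \<Longrightarrow> y \<noteq> 0 \<Longrightarrow> f x y = g x y"
  shows "smooth_expr U g"
  using assms higher_differentiable_on_cong[OF open_slit[OF assms(1)],
      of "\<lambda>p. f (fst p) (snd p)" "\<lambda>p. g (fst p) (snd p)"]
  unfolding smooth_expr_def smooth_on_def by auto

lemma smooth_expr_dir_deriv: "smooth_expr U f \<Longrightarrow> smooth_expr U (dir_deriv e f)"
  unfolding smooth_expr_def dir_deriv_def by (simp add: smooth_on_frechet_derivative)

lemma dir_deriv_commute:
  assumes "open U" "smooth_expr U f" "x \<in> U" "y \<noteq> 0"
  shows "dir_deriv e (dir_deriv e' f) x y = dir_deriv e' (dir_deriv e f) x y"
  using second_derivative_symmetric[OF open_slit[OF assms(1)] assms(2)[unfolded smooth_expr_def], of "(x, y)" e' e]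
    assms unfolding dir_deriv_def by simp

lemma dir_deriv_cong:
  assumes "open U" "x \<in> U" "y \<noteq> 0" "smooth_expr U f" "\<And>x y. x \<in> U \<Longrightarrow> y \<noteq> 0 \<Longrightarrow> f x y = g x y"
  shows "dir_deriv e f x y = dir_deriv e g x y"
  unfolding dir_deriv_def
  using frechet_derivative_transform_within_open[OF _ open_slit[OF assms(1)], of
      "\<lambda>p. f (fst p) (snd p)" "(x, y)" "\<lambda>p. g (fst p) (snd p)"]
    smooth_on_differentiable[of "U \<times> - {0}" "\<lambda>p. f (fst p) (snd p)" "(x, y)"] assms
  by (auto simp: smooth_expr_def)

lemma DERIV_unique_eventually:
  assumes "(f has_real_derivative a) (at t)" "(g has_real_derivative b) (at t)"
    and "eventually (\<lambda>t. g t = f t) (nhds t)"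
  shows "a = b"
  using DERIV_unique[of f a t b] DERIV_cong_ev[OF refl assms(3) refl, of b] assms(1,2) by simp

section \<open>Smooth functions and their partial derivatives over a coordinate domain\<close>

locale open_region =
  fixes U :: "(real ^ 'n::finite) set"
  assumes open_U: "open U"
begin

abbreviation sm :: "'n coord_fun \<Rightarrow> bool" where "sm \<equiv> smooth_expr U"

lemma sm_const [simp, intro]: "sm (\<lambda>x y. c)"
  by (simp add: smooth_expr_def smooth_on_def higher_differentiable_on_const)

lemma sm_y [simp, intro]: "sm (\<lambda>x y. y $ i)"
  unfolding smooth_expr_def smooth_on_def
  by (auto intro!: higher_differentiable_on_bounded_linear bounded_linear_intros
      bounded_linear_compose[OF bounded_linear_vec_nth])

lemma sm_add [simp, intro]: "sm f \<Longrightarrow> sm g \<Longrightarrow> sm (\<lambda>x y. f x y + g x y)"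
  unfolding smooth_expr_def smooth_on_def
  using higher_differentiable_on_add[OF open_slit[OF open_U]] by blast

lemma sm_mult [simp, intro]: "sm f \<Longrightarrow> sm g \<Longrightarrow> sm (\<lambda>x y. f x y * g x y)"
  unfolding smooth_expr_def smooth_on_def
  using higher_differentiable_on_mult[OF open_slit[OF open_U]] by blast

lemma sm_uminus [simp, intro]: "sm f \<Longrightarrow> sm (\<lambda>x y. - f x y)"
  using sm_mult[of "\<lambda>x y. -1" f] by simp

lemma sm_diff [simp, intro]: "sm f \<Longrightarrow> sm g \<Longrightarrow> sm (\<lambda>x y. f x y - g x y)"
  using sm_add[of f "\<lambda>x y. - g x y"] by simp

lemma sm_sum [simp, intro]: "(\<And>i. i \<in> A \<Longrightarrow> sm (f i)) \<Longrightarrow> sm (\<lambda>x y. \<Sum>i\<in>A. f i x y)"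
  by (induction A rule: infinite_finite_induct) auto

lemma sm_prod [simp, intro]: "(\<And>i. i \<in> A \<Longrightarrow> sm (f i)) \<Longrightarrow> sm (\<lambda>x y. \<Prod>i\<in>A. f i x y)"
  by (induction A rule: infinite_finite_induct) auto

lemma sm_power [simp, intro]: "sm f \<Longrightarrow> sm (\<lambda>x y. f x y ^ k)"
  by (induction k) auto

lemma sm_cdivide [simp, intro]: "sm f \<Longrightarrow> sm (\<lambda>x y. f x y / c)"
  using sm_mult[of f "\<lambda>x y. 1 / c"] by simp

lemma sm_if [simp, intro]: "sm f \<Longrightarrow> sm g \<Longrightarrow> sm (\<lambda>x y. if P then f x y else g x y)"
  by (cases P) auto

lemma sm_divide:
  assumes "sm f" "sm g" "\<And>x y. x \<in> U \<Longrightarrow> y \<noteq> 0 \<Longrightarrow> g x y \<noteq> 0"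
  shows "sm (\<lambda>x y. f x y / g x y)"
proof -
  have "sm (\<lambda>x y. inverse (g x y))"
    using assms(2,3) unfolding smooth_expr_def smooth_on_def
    by (auto intro!: higher_differentiable_on_inverse open_slit open_U)
  then show ?thesis using sm_mult[OF assms(1)] by (simp add: divide_inverse)
qed

lemma sm_dx [simp, intro]: "sm f \<Longrightarrow> sm (dx i f)"
  by (rule smooth_expr_cong[OF open_U smooth_expr_dir_deriv]) (auto simp: dx_eq_dir_deriv)

lemma sm_dy [simp, intro]: "sm f \<Longrightarrow> sm (dy i f)"
  by (rule smooth_expr_cong[OF open_U smooth_expr_dir_deriv]) (auto simp: dy_eq_dir_deriv)

lemma dir_deriv_const: "dir_deriv e (\<lambda>x y. c) x y = 0"
  by (simp add: dir_deriv_def)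

lemma dir_deriv_y: "dir_deriv e (\<lambda>x y. y $ i) x y = snd e $ i"
  by (rule has_derivative_dir_deriv)
    (auto intro!: bounded_linear_imp_has_derivative bounded_linear_intros
      bounded_linear_compose[OF bounded_linear_vec_nth])

lemma dir_deriv_add:
  assumes "sm f" "sm g" "x \<in> U" "y \<noteq> 0"
  shows "dir_deriv e (\<lambda>x y. f x y + g x y) x y = dir_deriv e f x y + dir_deriv e g x y"
  by (rule has_derivative_dir_deriv[OF has_derivative_add])
    (use assms smooth_expr_has_derivative in auto)

lemma dir_deriv_mult:
  assumes "sm f" "sm g" "x \<in> U" "y \<noteq> 0"
  shows "dir_deriv e (\<lambda>x y. f x y * g x y) x y = dir_deriv e f x y * g x y + f x y * dir_deriv e g x y"
  using has_derivative_dir_deriv[OF has_derivative_mult[OF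
      smooth_expr_has_derivative[OF assms(1,3,4)] smooth_expr_has_derivative[OF assms(2,3,4)]], of e]
  by simp

lemma dx_const [simp]: "x \<in> U \<Longrightarrow> y \<noteq> 0 \<Longrightarrow> dx i (\<lambda>x y. c) x y = 0"
  by (subst dx_eq_dir_deriv[where U = U]) (auto simp: dir_deriv_const)

lemma dy_const [simp]: "x \<in> U \<Longrightarrow> y \<noteq> 0 \<Longrightarrow> dy i (\<lambda>x y. c) x y = 0"
  by (subst dy_eq_dir_deriv[where U = U]) (auto simp: dir_deriv_const)

lemma dx_y [simp]: "x \<in> U \<Longrightarrow> y \<noteq> 0 \<Longrightarrow> dx i (\<lambda>x y. y $ j) x y = 0"
  by (subst dx_eq_dir_deriv[where U = U]) (auto simp: dir_deriv_y)

lemma dy_y [simp]: "x \<in> U \<Longrightarrow> y \<noteq> 0 \<Longrightarrow> dy i (\<lambda>x y. y $ j) x y = (if i = j then 1 else 0)"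
  by (subst dy_eq_dir_deriv[where U = U]) (auto simp: dir_deriv_y axis_def)

context
  fixes x y :: "real ^ 'n"
  assumes xy: "x \<in> U" "y \<noteq> 0"
begin

lemma dx_add: "sm f \<Longrightarrow> sm g \<Longrightarrow> dx i (\<lambda>x y. f x y + g x y) x y = dx i f x y + dx i g x y"
  using xy by (simp add: dx_eq_dir_deriv[where U = U] dir_deriv_add)

lemma dy_add: "sm f \<Longrightarrow> sm g \<Longrightarrow> dy i (\<lambda>x y. f x y + g x y) x y = dy i f x y + dy i g x y"
  using xy by (simp add: dy_eq_dir_deriv[where U = U] dir_deriv_add)

lemma dx_mult: "sm f \<Longrightarrow> sm g \<Longrightarrow> dx i (\<lambda>x y. f x y * g x y) x y = dx i f x y * g x y + f x y * dx i g x y"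
  using xy by (simp add: dx_eq_dir_deriv[where U = U] dir_deriv_mult)

lemma dy_mult: "sm f \<Longrightarrow> sm g \<Longrightarrow> dy i (\<lambda>x y. f x y * g x y) x y = dy i f x y * g x y + f x y * dy i g x y"
  using xy by (simp add: dy_eq_dir_deriv[where U = U] dir_deriv_mult)

lemma dx_uminus: "sm f \<Longrightarrow> dx i (\<lambda>x y. - f x y) x y = - dx i f x y"
  using xy dx_mult[of "\<lambda>x y. -1" f] by simp

lemma dy_uminus: "sm f \<Longrightarrow> dy i (\<lambda>x y. - f x y) x y = - dy i f x y"
  using xy dy_mult[of "\<lambda>x y. -1" f] by simp

lemma dx_diff: "sm f \<Longrightarrow> sm g \<Longrightarrow> dx i (\<lambda>x y. f x y - g x y) x y = dx i f x y - dx i g x y"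
  using dx_add[of f "\<lambda>x y. - g x y"] by (simp add: dx_uminus)

lemma dy_diff: "sm f \<Longrightarrow> sm g \<Longrightarrow> dy i (\<lambda>x y. f x y - g x y) x y = dy i f x y - dy i g x y"
  using dy_add[of f "\<lambda>x y. - g x y"] by (simp add: dy_uminus)

lemma dx_sum: "(\<And>k. k \<in> A \<Longrightarrow> sm (f k)) \<Longrightarrow> dx i (\<lambda>x y. \<Sum>k\<in>A. f k x y) x y = (\<Sum>k\<in>A. dx i (f k) x y)"
  by (induction A rule: infinite_finite_induct) (auto simp: dx_add xy)

lemma dy_sum: "(\<And>k. k \<in> A \<Longrightarrow> sm (f k)) \<Longrightarrow> dy i (\<lambda>x y. \<Sum>k\<in>A. f k x y) x y = (\<Sum>k\<in>A. dy i (f k) x y)"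
  by (induction A rule: infinite_finite_induct) (auto simp: dy_add xy)

lemma dx_cong:
  assumes "sm f" "\<And>x y. x \<in> U \<Longrightarrow> y \<noteq> 0 \<Longrightarrow> f x y = g x y"
  shows "dx i f x y = dx i g x y"
  using xy assms smooth_expr_cong[OF open_U assms]
  by (simp add: dx_eq_dir_deriv[where U = U] dir_deriv_cong[OF open_U _ _ assms])

lemma dy_cong:
  assumes "sm f" "\<And>x y. x \<in> U \<Longrightarrow> y \<noteq> 0 \<Longrightarrow> f x y = g x y"
  shows "dy i f x y = dy i g x y"
  using xy assms smooth_expr_cong[OF open_U assms]
  by (simp add: dy_eq_dir_deriv[where U = U] dir_deriv_cong[OF open_U _ _ assms])

lemma dx_dir_deriv: "sm f \<Longrightarrow> dx i (dir_deriv e f) x y = dir_deriv (axis i 1, 0) (dir_deriv e f) x y"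
  using xy by (simp add: dx_eq_dir_deriv[where U = U] smooth_expr_dir_deriv)

lemma dy_dir_deriv: "sm f \<Longrightarrow> dy i (dir_deriv e f) x y = dir_deriv (0, axis i 1) (dir_deriv e f) x y"
  using xy by (simp add: dy_eq_dir_deriv[where U = U] smooth_expr_dir_deriv)

lemma dy_commute: "sm f \<Longrightarrow> dy i (dy j f) x y = dy j (dy i f) x y"
  using xy dy_cong[of "dy j f" "dir_deriv (0, axis j 1) f" i] dy_cong[of "dy i f" "dir_deriv (0, axis i 1) f" j]
  by (simp add: dy_dir_deriv dy_eq_dir_deriv[where U = U and f = f] dir_deriv_commute[OF open_U])

lemma dy_dx_commute: "sm f \<Longrightarrow> dy i (dx j f) x y = dx j (dy i f) x y"
  using xy dy_cong[of "dx j f" "dir_deriv (axis j 1, 0) f" i] dx_cong[of "dy i f" "dir_deriv (0, axis i 1) f" j]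
  by (simp add: dx_dir_deriv dy_dir_deriv dx_eq_dir_deriv[where U = U and f = f]
      dy_eq_dir_deriv[where U = U and f = f] dir_deriv_commute[OF open_U])

end

section \<open>Positive homogeneity in \<open>y\<close> and Euler's identity\<close>

definition hom :: "nat \<Rightarrow> 'n coord_fun \<Rightarrow> bool" where
  "hom p f \<longleftrightarrow> (\<forall>x\<in>U. \<forall>y. y \<noteq> 0 \<longrightarrow> (\<forall>a>0. f x (a *\<^sub>R y) = a ^ p * f x y))"

lemma homI: "(\<And>x y a. x \<in> U \<Longrightarrow> y \<noteq> 0 \<Longrightarrow> a > 0 \<Longrightarrow> f x (a *\<^sub>R y) = a ^ p * f x y) \<Longrightarrow> hom p f"
  by (simp add: hom_def)

lemma homD: "hom p f \<Longrightarrow> x \<in> U \<Longrightarrow> y \<noteq> 0 \<Longrightarrow> a > 0 \<Longrightarrow> f x (a *\<^sub>R y) = a ^ p * f x y"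
  by (simp add: hom_def)

lemma hom_y: "hom 1 (\<lambda>x y. y $ i)"
  by (simp add: hom_def)

lemma hom_diff: "hom p f \<Longrightarrow> hom p g \<Longrightarrow> hom p (\<lambda>x y. f x y - g x y)"
  by (simp add: hom_def right_diff_distrib)

lemma hom_mult: "hom p f \<Longrightarrow> hom q g \<Longrightarrow> hom (p + q) (\<lambda>x y. f x y * g x y)"
  by (simp add: hom_def power_add)

lemma hom_cmult: "hom p f \<Longrightarrow> hom p (\<lambda>x y. c * f x y)"
  by (simp add: hom_def)

lemma hom_sum: "(\<And>i. i \<in> A \<Longrightarrow> hom p (f i)) \<Longrightarrow> hom p (\<lambda>x y. \<Sum>i\<in>A. f i x y)"
  by (simp add: hom_def sum_distrib_left)

text \<open>Differentiating \<open>f x (a y) = a^(p+1) f x y\<close> in \<open>y\<close> produces a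
  factor \<open>a\<close> on the left, which cancels one power on the right.\<close>

lemma hom_dy:
  assumes "sm f" "hom (Suc p) f"
  shows "hom p (dy i f)"
proof (rule homI)
  fix x y :: "real ^ 'n" and a :: real
  assume xy: "x \<in> U" "y \<noteq> 0" "a > 0"
  have "((\<lambda>t. f x (a *\<^sub>R (y + t *\<^sub>R axis i 1))) has_real_derivative
      dir_deriv (0, a *\<^sub>R axis i 1) f x (a *\<^sub>R (y + 0 *\<^sub>R axis i 1))) (at 0)"
    using xy by (intro smooth_expr_curve[OF assms(1)]) (auto intro!: derivative_eq_intros simp: algebra_simps)
  moreover have "((\<lambda>t. a ^ Suc p * f x (y + t *\<^sub>R axis i 1)) has_real_derivative
      a ^ Suc p * dir_deriv (0, axis i 1) f x (y + 0 *\<^sub>R axis i 1)) (at 0)"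
    using xy by (intro DERIV_cmult smooth_expr_curve[OF assms(1)]) (auto intro!: derivative_eq_intros)
  moreover have "eventually (\<lambda>t. a ^ Suc p * f x (y + t *\<^sub>R axis i 1) = f x (a *\<^sub>R (y + t *\<^sub>R axis i 1))) (nhds 0)"
  proof -
    have "((\<lambda>t. y + t *\<^sub>R axis i 1) \<longlongrightarrow> y + 0 *\<^sub>R axis i 1) (nhds 0)"
      by (intro tendsto_intros filterlim_ident)
    then have "eventually (\<lambda>t. y + t *\<^sub>R axis i 1 \<noteq> 0) (nhds 0)"
      using xy by (intro tendsto_imp_eventually_ne) auto
    then show ?thesis
      by eventually_elim (use xy homD[OF assms(2)] in auto)
  qed
  ultimately have "dir_deriv (0, a *\<^sub>R axis i 1) f x (a *\<^sub>R y) = a ^ Suc p * dir_deriv (0, axis i 1) f x y"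
    by (auto dest: DERIV_unique_eventually)
  moreover have "dir_deriv (0, a *\<^sub>R axis i 1) f x (a *\<^sub>R y) = a * dir_deriv (0, axis i 1) f x (a *\<^sub>R y)"
    using linear_cmul[OF has_derivative_linear[OF smooth_expr_has_derivative[OF assms(1)]], of x "a *\<^sub>R y" a "(0, axis i 1)"]
      xy by simp
  ultimately show "dy i f x (a *\<^sub>R y) = a ^ p * dy i f x y"
    using xy by (simp add: dy_eq_dir_deriv[OF assms(1)])
qed

lemma hom_dx:
  assumes "sm f" "hom p f"
  shows "hom p (dx i f)"
proof (rule homI)
  fix x y :: "real ^ 'n" and a :: real
  assume xy: "x \<in> U" "y \<noteq> 0" "a > 0"
  have "((\<lambda>t. f (x + t *\<^sub>R axis i 1) (a *\<^sub>R y)) has_real_derivative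
      dir_deriv (axis i 1, 0) f (x + 0 *\<^sub>R axis i 1) (a *\<^sub>R y)) (at 0)"
    using xy by (intro smooth_expr_curve[OF assms(1)]) (auto intro!: derivative_eq_intros)
  moreover have "((\<lambda>t. a ^ p * f (x + t *\<^sub>R axis i 1) y) has_real_derivative
      a ^ p * dir_deriv (axis i 1, 0) f (x + 0 *\<^sub>R axis i 1) y) (at 0)"
    using xy by (intro DERIV_cmult smooth_expr_curve[OF assms(1)]) (auto intro!: derivative_eq_intros)
  moreover have "eventually (\<lambda>t. a ^ p * f (x + t *\<^sub>R axis i 1) y = f (x + t *\<^sub>R axis i 1) (a *\<^sub>R y)) (nhds 0)"
  proof -
    have "((\<lambda>t. x + t *\<^sub>R axis i 1) \<longlongrightarrow> x + 0 *\<^sub>R axis i 1) (nhds 0)"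
      by (intro tendsto_intros filterlim_ident)
    then have "eventually (\<lambda>t. x + t *\<^sub>R axis i 1 \<in> U) (nhds 0)"
      using xy open_U topological_tendstoD by fastforce
    then show ?thesis
      by eventually_elim (use xy homD[OF assms(2)] in auto)
  qed
  ultimately have "dir_deriv (axis i 1, 0) f x (a *\<^sub>R y) = a ^ p * dir_deriv (axis i 1, 0) f x y"
    by (auto dest: DERIV_unique_eventually)
  then show "dx i f x (a *\<^sub>R y) = a ^ p * dx i f x y"
    using xy by (simp add: dx_eq_dir_deriv[OF assms(1)])
qed

lemma dir_deriv_vertical:
  assumes "sm f" "x \<in> U" "y \<noteq> 0"
  shows "dir_deriv (0, v) f x y = (\<Sum>r\<in>UNIV. v $ r * dy r f x y)"
proof -
  have lin: "linear (\<lambda>e. dir_deriv e f x y)"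
    by (rule has_derivative_linear[OF smooth_expr_has_derivative[OF assms]])
  have "v = (\<Sum>r\<in>UNIV. v $ r *\<^sub>R axis r 1)"
    using basis_expansion[of v] by (simp add: scalar_mult_eq_scaleR)
  then have "(0, v) = (\<Sum>r\<in>UNIV. v $ r *\<^sub>R (0 :: real ^ 'n, axis r 1 :: real ^ 'n))"
    by (auto simp: prod_eq_iff fst_sum snd_sum)
  then have "dir_deriv (0, v) f x y = (\<Sum>r\<in>UNIV. v $ r *\<^sub>R dir_deriv (0, axis r 1) f x y)"
    by (simp only: linear_sum[OF lin] linear_cmul[OF lin])
  then show ?thesis using assms by (simp add: dy_eq_dir_deriv)
qed

text \<open>Both sides are the derivative at \<open>t = 1\<close> of
  \<open>f x (t y) = t^p f x y\<close>.\<close>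

lemma euler:
  assumes "sm f" "hom p f" "x \<in> U" "y \<noteq> 0"
  shows "(\<Sum>r\<in>UNIV. y $ r * dy r f x y) = p * f x y"
proof -
  have "((\<lambda>t. f x (t *\<^sub>R y)) has_real_derivative dir_deriv (0, y) f x (1 *\<^sub>R y)) (at 1)"
    using assms by (intro smooth_expr_curve[OF assms(1)]) (auto intro!: derivative_eq_intros)
  moreover have "((\<lambda>t. t ^ p * f x y) has_real_derivative (p * f x y)) (at 1)"
    by (auto intro!: derivative_eq_intros)
  moreover have "eventually (\<lambda>t::real. t ^ p * f x y = f x (t *\<^sub>R y)) (nhds 1)"
  proof -
    have "eventually (\<lambda>t::real. t \<in> {0<..}) (nhds 1)"
      by (intro eventually_nhds_in_open) auto
    then show ?thesis
      by eventually_elim (use assms homD[OF assms(2)] in auto)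
  qed
  ultimately have "dir_deriv (0, y) f x y = p * f x y"
    by (auto dest: DERIV_unique_eventually)
  then show ?thesis using assms by (simp add: dir_deriv_vertical)
qed

text \<open>The partial derivatives cut off outside the slit tangent bundle: symmetry of mixed partial
  derivatives then holds as an equation between functions, so it rewrites inside further derivatives.\<close>

definition xd :: "'n \<Rightarrow> 'n coord_fun \<Rightarrow> 'n coord_fun" where
  "xd i f = (\<lambda>x y. if x \<in> U \<and> y \<noteq> 0 then dx i f x y else 0)"

definition yd :: "'n \<Rightarrow> 'n coord_fun \<Rightarrow> 'n coord_fun" where
  "yd i f = (\<lambda>x y. if x \<in> U \<and> y \<noteq> 0 then dy i f x y else 0)"

text \<open>The constant 1 with the same cut-off as \<open>xd\<close> and \<open>yd\<close>. It
  appears in the derivative of the coordinate \<open>y $ i\<close>, so that this rule too is an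
  equation between functions.\<close>

definition one :: "'n coord_fun" where
  "one = (\<lambda>x y. if x \<in> U \<and> y \<noteq> 0 then 1 else 0)"

lemma xd_eq: "x \<in> U \<Longrightarrow> y \<noteq> 0 \<Longrightarrow> xd i f x y = dx i f x y"
  by (simp add: xd_def)

lemma yd_eq: "x \<in> U \<Longrightarrow> y \<noteq> 0 \<Longrightarrow> yd i f x y = dy i f x y"
  by (simp add: yd_def)

lemma xd_outside [simp]: "\<not> (x \<in> U \<and> y \<noteq> 0) \<Longrightarrow> xd i f x y = 0"
  by (auto simp: xd_def)

lemma yd_outside [simp]: "\<not> (x \<in> U \<and> y \<noteq> 0) \<Longrightarrow> yd i f x y = 0"
  by (auto simp: yd_def)

lemma sm_xd [simp, intro]: "sm f \<Longrightarrow> sm (xd i f)"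
  by (rule smooth_expr_cong[OF open_U sm_dx]) (auto simp: xd_eq)

lemma sm_yd [simp, intro]: "sm f \<Longrightarrow> sm (yd i f)"
  by (rule smooth_expr_cong[OF open_U sm_dy]) (auto simp: yd_eq)

lemma sm_one [simp]: "sm one"
  by (rule smooth_expr_cong[OF open_U sm_const[of 1]]) (simp add: one_def)

lemma xd_cong: "sm f \<Longrightarrow> (\<And>x y. x \<in> U \<Longrightarrow> y \<noteq> 0 \<Longrightarrow> f x y = g x y) \<Longrightarrow> xd i f = xd i g"
  unfolding xd_def using dx_cong by (intro ext) auto

lemma yd_cong: "sm f \<Longrightarrow> (\<And>x y. x \<in> U \<Longrightarrow> y \<noteq> 0 \<Longrightarrow> f x y = g x y) \<Longrightarrow> yd i f = yd i g"
  unfolding yd_def using dy_cong by (intro ext) auto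

lemma xd_add [simp]: "sm f \<Longrightarrow> sm g \<Longrightarrow> xd i (\<lambda>x y. f x y + g x y) = (\<lambda>x y. xd i f x y + xd i g x y)"
  by (intro ext) (simp add: xd_def dx_add)

lemma yd_add [simp]: "sm f \<Longrightarrow> sm g \<Longrightarrow> yd i (\<lambda>x y. f x y + g x y) = (\<lambda>x y. yd i f x y + yd i g x y)"
  by (intro ext) (simp add: yd_def dy_add)

lemma xd_diff [simp]: "sm f \<Longrightarrow> sm g \<Longrightarrow> xd i (\<lambda>x y. f x y - g x y) = (\<lambda>x y. xd i f x y - xd i g x y)"
  by (intro ext) (simp add: xd_def dx_diff)

lemma yd_diff [simp]: "sm f \<Longrightarrow> sm g \<Longrightarrow> yd i (\<lambda>x y. f x y - g x y) = (\<lambda>x y. yd i f x y - yd i g x y)"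
  by (intro ext) (simp add: yd_def dy_diff)

lemma xd_mult [simp]: "sm f \<Longrightarrow> sm g \<Longrightarrow>
    xd i (\<lambda>x y. f x y * g x y) = (\<lambda>x y. xd i f x y * g x y + f x y * xd i g x y)"
  by (intro ext) (simp add: xd_def dx_mult)

lemma yd_mult [simp]: "sm f \<Longrightarrow> sm g \<Longrightarrow>
    yd i (\<lambda>x y. f x y * g x y) = (\<lambda>x y. yd i f x y * g x y + f x y * yd i g x y)"
  by (intro ext) (simp add: yd_def dy_mult)

lemma xd_const [simp]: "xd i (\<lambda>x y. c) = (\<lambda>x y. 0)"
  by (intro ext) (simp add: xd_def)

lemma yd_const [simp]: "yd i (\<lambda>x y. c) = (\<lambda>x y. 0)"
  by (intro ext) (simp add: yd_def)

lemma xd_sum [simp]: "(\<And>k. k \<in> A \<Longrightarrow> sm (f k)) \<Longrightarrow>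
    xd i (\<lambda>x y. \<Sum>k\<in>A. f k x y) = (\<lambda>x y. \<Sum>k\<in>A. xd i (f k) x y)"
  by (intro ext) (auto simp: xd_def dx_sum intro!: sum.neutral)

lemma yd_sum [simp]: "(\<And>k. k \<in> A \<Longrightarrow> sm (f k)) \<Longrightarrow>
    yd i (\<lambda>x y. \<Sum>k\<in>A. f k x y) = (\<lambda>x y. \<Sum>k\<in>A. yd i (f k) x y)"
  by (intro ext) (auto simp: yd_def dy_sum intro!: sum.neutral)

lemma xd_y [simp]: "xd i (\<lambda>x y. y $ j) = (\<lambda>x y. 0)"
  by (intro ext) (simp add: xd_def)

lemma yd_y [simp]: "yd i (\<lambda>x y. y $ j) = (\<lambda>x y. (if i = j then 1 else 0) * one x y)"
  by (intro ext) (simp add: yd_def one_def)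

lemma yd_one [simp]: "yd i one = (\<lambda>x y. 0)"
  using yd_cong[of "\<lambda>x y. 1" one i] by (simp add: one_def)

lemma xd_one [simp]: "xd i one = (\<lambda>x y. 0)"
  using xd_cong[of "\<lambda>x y. 1" one i] by (simp add: one_def)

lemma yd_commute: "sm f \<Longrightarrow> yd i (yd j f) = yd j (yd i f)"
proof -
  assume f: "sm f"
  have "yd i (yd j f) = yd i (dy j f)" "yd j (yd i f) = yd j (dy i f)"
    using f by (auto intro!: yd_cong simp: yd_eq)
  then show ?thesis using dy_commute f by (auto simp: yd_def fun_eq_iff)
qed

lemma yd_xd: "sm f \<Longrightarrow> yd i (xd j f) = xd j (yd i f)"
proof -
  assume f: "sm f"
  have "yd i (xd j f) = yd i (dx j f)" "xd j (yd i f) = xd j (dy i f)"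
    using f by (auto intro!: yd_cong xd_cong simp: yd_eq xd_eq)
  then show ?thesis using dy_dx_commute f by (auto simp: yd_def xd_def fun_eq_iff)
qed

lemma hom_cong: "hom p f \<Longrightarrow> (\<And>x y. x \<in> U \<Longrightarrow> y \<noteq> 0 \<Longrightarrow> f x y = g x y) \<Longrightarrow> hom p g"
  by (simp add: hom_def)

lemma hom_yd: "sm f \<Longrightarrow> hom (Suc p) f \<Longrightarrow> hom p (yd i f)"
  by (rule hom_cong[OF hom_dy]) (auto simp: yd_eq)

lemma hom_xd: "sm f \<Longrightarrow> hom p f \<Longrightarrow> hom p (xd i f)"
  by (rule hom_cong[OF hom_dx]) (auto simp: xd_eq)

lemma euler_yd: "sm f \<Longrightarrow> hom p f \<Longrightarrow> x \<in> U \<Longrightarrow> y \<noteq> 0 \<Longrightarrow> (\<Sum>r\<in>UNIV. y $ r * yd r f x y) = p * f x y"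
  by (simp add: yd_eq euler)

lemma yd2_eq: "sm f \<Longrightarrow> x \<in> U \<Longrightarrow> y \<noteq> 0 \<Longrightarrow> yd j (yd k f) x y = dy j (dy k f) x y"
  using yd_cong[of "yd k f" "dy k f" j] by (simp add: yd_eq)

lemma yd3_eq: "sm f \<Longrightarrow> x \<in> U \<Longrightarrow> y \<noteq> 0 \<Longrightarrow> yd j (yd k (yd l f)) x y = dy j (dy k (dy l f)) x y"
  using yd_cong[of "yd k (yd l f)" "dy k (dy l f)" j] yd2_eq by (simp add: yd_eq)

text \<open>Multiplying the derivative of \<open>f * g = 0\<close> by \<open>f\<close> leaves \<open>f\<^sup>2\<close> times the derivative of \<open>g\<close>. This
  replaces a restriction to the open set where \<open>f\<close> does not vanish.\<close>

lemma yd_annihilated: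
  assumes "sm f" "sm g" "(\<lambda>x y. f x y * g x y) = (\<lambda>x y. 0)"
  shows "f x y * yd k g x y = 0"
  using fun_cong[OF fun_cong[OF arg_cong[OF assms(3), of "yd k"], of x], of y]
    fun_cong[OF fun_cong[OF assms(3), of x], of y] assms(1,2) by auto

lemma xd_annihilated:
  assumes "sm f" "sm g" "(\<lambda>x y. f x y * g x y) = (\<lambda>x y. 0)"
  shows "f x y * xd k g x y = 0"
  using fun_cong[OF fun_cong[OF arg_cong[OF assms(3), of "xd k"], of x], of y]
    fun_cong[OF fun_cong[OF assms(3), of x], of y] assms(1,2) by auto

end

section \<open>Sprays\<close>

locale spray_region = open_region U for U :: "(real ^ 'n::finite) set" +
  fixes G :: "'n \<Rightarrow> 'n coord_fun"
  assumes sm_G [simp, intro]: "sm (G i)"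
begin

abbreviation N :: "'n \<Rightarrow> 'n \<Rightarrow> 'n coord_fun" where "N i j \<equiv> yd j (G i)"

abbreviation B :: "'n \<Rightarrow> 'n \<Rightarrow> 'n \<Rightarrow> 'n \<Rightarrow> 'n coord_fun" where
  "B j i k l \<equiv> yd j (yd k (yd l (G i)))"

text \<open>The spray vector field \<open>y^k d/dx^k - 2 G^k d/dy^k\<close> as a derivation. For
  \<open>G\<close> homogeneous of degree 2 it is \<open>y^m\<close> times the horizontal derivative
  along \<open>x^m\<close>.\<close>

definition spray_deriv :: "'n coord_fun \<Rightarrow> 'n coord_fun" where
  "spray_deriv f = (\<lambda>x y. (\<Sum>k\<in>UNIV. y $ k * xd k f x y) - 2 * (\<Sum>k\<in>UNIV. G k x y * yd k f x y))"

lemma sm_spray_deriv [simp, intro]: "sm f \<Longrightarrow> sm (spray_deriv f)"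
  unfolding spray_deriv_def by auto

lemma spray_deriv_outside [simp]: "\<not> (x \<in> U \<and> y \<noteq> 0) \<Longrightarrow> spray_deriv f x y = 0"
  by (simp add: spray_deriv_def)

lemma spray_deriv_add [simp]: "sm f \<Longrightarrow> sm g \<Longrightarrow>
    spray_deriv (\<lambda>x y. f x y + g x y) = (\<lambda>x y. spray_deriv f x y + spray_deriv g x y)"
  by (simp add: spray_deriv_def distrib_left sum.distrib fun_eq_iff)

lemma spray_deriv_diff [simp]: "sm f \<Longrightarrow> sm g \<Longrightarrow>
    spray_deriv (\<lambda>x y. f x y - g x y) = (\<lambda>x y. spray_deriv f x y - spray_deriv g x y)"
  by (simp add: spray_deriv_def right_diff_distrib sum_subtractf fun_eq_iff)

lemma spray_deriv_mult [simp]: "sm f \<Longrightarrow> sm g \<Longrightarrow>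
    spray_deriv (\<lambda>x y. f x y * g x y) = (\<lambda>x y. spray_deriv f x y * g x y + f x y * spray_deriv g x y)"
  by (simp add: spray_deriv_def distrib_left sum.distrib fun_eq_iff algebra_simps sum_distrib_left)

lemma spray_deriv_const [simp]: "spray_deriv (\<lambda>x y. c) = (\<lambda>x y. 0)"
  by (simp add: spray_deriv_def)

lemma spray_deriv_sum [simp]: "finite A \<Longrightarrow> (\<And>k. k \<in> A \<Longrightarrow> sm (f k)) \<Longrightarrow>
    spray_deriv (\<lambda>x y. \<Sum>k\<in>A. f k x y) = (\<lambda>x y. \<Sum>k\<in>A. spray_deriv (f k) x y)"
  by (induction A rule: finite_induct) auto

text \<open>The commutator of \<open>d/dy^j\<close> with the spray field is
  \<open>d/dx^j - 2 N^r_j d/dy^r\<close>.\<close>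

lemma yd_spray_deriv: "sm f \<Longrightarrow> yd j (spray_deriv f) =
    (\<lambda>x y. spray_deriv (yd j f) x y + xd j f x y - 2 * (\<Sum>r\<in>UNIV. N r j x y * yd r f x y))"
proof (intro ext)
  fix x y
  assume f: "sm f"
  show "yd j (spray_deriv f) x y =
    spray_deriv (yd j f) x y + xd j f x y - 2 * (\<Sum>r\<in>UNIV. N r j x y * yd r f x y)"
  proof (cases "x \<in> U \<and> y \<noteq> 0")
    case True
    have "(\<Sum>k\<in>UNIV. (if j = k then 1 else 0) * one x y * xd k f x y) = xd j f x y"
      using True by (simp add: one_def if_distrib[where f = "\<lambda>t. t * _"] cong: if_cong)
    then show ?thesis
      using f by (simp add: spray_deriv_def sum.distrib yd_xd yd_commute[of f j] algebra_simps)
  qed simp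
qed

text \<open>The operator \<nabla> on tensors of type (1,3), with \<open>y^m\<close> already
  contracted: Euler's identity turns the connection coefficients \<open>G^i_rm y^m\<close> into
  \<open>N i r\<close>.\<close>

definition spray_cov :: "('n \<Rightarrow> 'n \<Rightarrow> 'n \<Rightarrow> 'n \<Rightarrow> 'n coord_fun) \<Rightarrow> 'n \<Rightarrow> 'n \<Rightarrow> 'n \<Rightarrow> 'n \<Rightarrow> 'n coord_fun" where
  "spray_cov D j i k l = (\<lambda>x y. spray_deriv (D j i k l) x y
     + (\<Sum>r\<in>UNIV. D j r k l x y * N i r x y) - (\<Sum>r\<in>UNIV. D r i k l x y * N r j x y)
     - (\<Sum>r\<in>UNIV. D j i r l x y * N r k x y) - (\<Sum>r\<in>UNIV. D j i k r x y * N r l x y))"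

definition berwald_deriv :: "'n \<Rightarrow> 'n \<Rightarrow> 'n \<Rightarrow> 'n \<Rightarrow> 'n coord_fun" where
  "berwald_deriv = spray_cov B"

text \<open>The Riemann curvature with its second-order terms collected:
  \<open>y^j d/dx^j - 2 G^j d/dy^j\<close> applied to \<open>N i k\<close> is a spray
  derivative.\<close>

definition spray_riemann :: "'n \<Rightarrow> 'n \<Rightarrow> 'n coord_fun" where
  "spray_riemann i k = (\<lambda>x y. 2 * xd k (G i) x y - spray_deriv (N i k) x y
     - (\<Sum>r\<in>UNIV. N i r x y * N r k x y))"

lemma spray_deriv_annihilated:
  assumes "sm f" "sm g" "(\<lambda>x y. f x y * g x y) = (\<lambda>x y. 0)"
  shows "f x y * spray_deriv g x y = 0"
  using fun_cong[OF fun_cong[OF arg_cong[OF assms(3), of spray_deriv], of x], of y]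
    fun_cong[OF fun_cong[OF assms(3), of x], of y] assms(1,2) by auto

lemma spray_deriv_y: "x \<in> U \<Longrightarrow> y \<noteq> 0 \<Longrightarrow> spray_deriv (\<lambda>x y. y $ i) x y = - 2 * G i x y"
  by (simp add: spray_deriv_def one_def if_distrib[where f = "\<lambda>t. t * _"]
      if_distrib[where f = "\<lambda>t. _ * t"] cong: if_cong)

definition spray_cov2 :: "('n \<Rightarrow> 'n \<Rightarrow> 'n coord_fun) \<Rightarrow> 'n \<Rightarrow> 'n \<Rightarrow> 'n coord_fun" where
  "spray_cov2 f j k = (\<lambda>x y. spray_deriv (f j k) x y
     - (\<Sum>r\<in>UNIV. f r k x y * N r j x y) - (\<Sum>r\<in>UNIV. f j r x y * N r k x y))"

definition spray_cov3 :: "('n \<Rightarrow> 'n \<Rightarrow> 'n \<Rightarrow> 'n coord_fun) \<Rightarrow> 'n \<Rightarrow> 'n \<Rightarrow> 'n \<Rightarrow> 'n coord_fun" where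
  "spray_cov3 f j k l = (\<lambda>x y. spray_deriv (f j k l) x y - (\<Sum>r\<in>UNIV. f r k l x y * N r j x y)
     - (\<Sum>r\<in>UNIV. f j r l x y * N r k x y) - (\<Sum>r\<in>UNIV. f j k r x y * N r l x y))"

lemma spray_cov_add:
  assumes "\<And>j i k l. sm (D j i k l)" "\<And>j i k l. sm (D' j i k l)"
  shows "spray_cov (\<lambda>j i k l x y. D j i k l x y + D' j i k l x y) j i k l x y =
    spray_cov D j i k l x y + spray_cov D' j i k l x y"
  using assms by (simp add: spray_cov_def distrib_right sum.distrib)

lemma spray_cov_diff:
  assumes "\<And>j i k l. sm (D j i k l)" "\<And>j i k l. sm (D' j i k l)"
  shows "spray_cov (\<lambda>j i k l x y. D j i k l x y - D' j i k l x y) j i k l x y =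
    spray_cov D j i k l x y - spray_cov D' j i k l x y"
  using assms by (simp add: spray_cov_def left_diff_distrib sum_subtractf)

text \<open>The Kronecker delta is parallel: the connection terms of the upper index
  \<open>i\<close> and the lower index \<open>l\<close> cancel. The two following lemmas treat the
  other positions.\<close>

lemma spray_cov_delta_l:
  assumes "\<And>j k. sm (f j k)"
  shows "spray_cov (\<lambda>j i k l x y. (if l = i then 1 else 0) * f j k x y) j i k l x y =
    (if l = i then 1 else 0) * spray_cov2 f j k x y"
  using assms by (simp add: spray_cov_def spray_cov2_def if_distrib[where f = "\<lambda>t. t * _"]
      if_distrib[where f = "\<lambda>t. _ * t"] cong: if_cong)

lemma spray_cov_delta_j:
  assumes "\<And>j k. sm (f j k)"
  shows "spray_cov (\<lambda>j i k l x y. (if j = i then 1 else 0) * f k l x y) j i k l x y =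
    (if j = i then 1 else 0) * spray_cov2 f k l x y"
  using assms by (simp add: spray_cov_def spray_cov2_def if_distrib[where f = "\<lambda>t. t * _"]
      if_distrib[where f = "\<lambda>t. _ * t"] cong: if_cong)

lemma spray_cov_delta_k:
  assumes "\<And>j k. sm (f j k)"
  shows "spray_cov (\<lambda>j i k l x y. (if k = i then 1 else 0) * f l j x y) j i k l x y =
    (if k = i then 1 else 0) * spray_cov2 f l j x y"
  using assms by (simp add: spray_cov_def spray_cov2_def if_distrib[where f = "\<lambda>t. t * _"]
      if_distrib[where f = "\<lambda>t. _ * t"] cong: if_cong)

text \<open>The field \<open>y\<close> is parallel along itself: its spray derivative
  \<open>- 2 G i\<close> cancels \<open>y^r N^i_r\<close>, which is \<open>2 G i\<close> by Euler's
  identity.\<close>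

lemma spray_cov_y:
  assumes "\<And>j k l. sm (f j k l)" "\<And>i. hom 2 (G i)" "x \<in> U" "y \<noteq> 0"
  shows "spray_cov (\<lambda>j i k l x y. f j k l x y * y $ i) j i k l x y = spray_cov3 f j k l x y * y $ i"
proof -
  have "(\<Sum>r\<in>UNIV. y $ r * N i r x y) = 2 * G i x y"
    using euler_yd[OF _ assms(2), of i x y] assms by simp
  then have "(\<Sum>r\<in>UNIV. f j k l x y * y $ r * N i r x y) = f j k l x y * (2 * G i x y)"
    by (simp only: mult.assoc sum_distrib_left[symmetric])
  then show ?thesis
    using assms by (simp add: spray_cov_def spray_cov3_def spray_deriv_y algebra_simps sum_distrib_left)
qed

text \<open>Leibniz rule for the contraction of a covector \<open>W\<close> with \<open>B\<close>,
  solved for the term containing \<nabla> \<open>B\<close>. Further indices of \<open>W\<close> are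
  held fixed here; their connection terms are added in the applications.\<close>

lemma contract_berwald_deriv:
  assumes "\<And>i. sm (W i)"
  shows "(\<Sum>i\<in>UNIV. W i x y * berwald_deriv j i k l x y) =
      spray_deriv (\<lambda>x y. \<Sum>i\<in>UNIV. W i x y * B j i k l x y) x y
    - (\<Sum>i\<in>UNIV. (spray_deriv (W i) x y - (\<Sum>r\<in>UNIV. N r i x y * W r x y)) * B j i k l x y)
    - (\<Sum>r\<in>UNIV. N r j x y * (\<Sum>i\<in>UNIV. W i x y * B r i k l x y)
        + N r k x y * (\<Sum>i\<in>UNIV. W i x y * B j i r l x y)
        + N r l x y * (\<Sum>i\<in>UNIV. W i x y * B j i k r x y))"
proof -
  have sw: "(\<Sum>r\<in>UNIV. N r a x y * (\<Sum>i\<in>UNIV. W i x y * X i r)) =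
      (\<Sum>i\<in>UNIV. \<Sum>r\<in>UNIV. W i x y * (X i r * N r a x y))" for a X
    unfolding sum_distrib_left by (subst sum.swap) (simp add: mult_ac)
  have sw': "(\<Sum>i\<in>UNIV. \<Sum>r\<in>UNIV. W i x y * (B j r k l x y * N i r x y)) =
      (\<Sum>i\<in>UNIV. (\<Sum>r\<in>UNIV. N r i x y * W r x y) * B j i k l x y)"
    unfolding sum_distrib_right by (subst sum.swap) (simp add: mult_ac)
  show ?thesis
    unfolding sum.distrib sw[of j "\<lambda>i r. B r i k l x y"] sw[of k "\<lambda>i r. B j i r l x y"]
      sw[of l "\<lambda>i r. B j i k r x y"] left_diff_distrib sum_subtractf sw'[symmetric]
    using assms by (simp add: berwald_deriv_def spray_cov_def distrib_left right_diff_distrib sum.distrib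
        sum_subtractf sum_distrib_left)
qed

text \<open>Moving three vertical derivatives past the spray field leaves terms that combine into
  vertical derivatives of \<nabla> \<open>B\<close>. This is why it suffices to show that \<nabla>
  \<open>B\<close> vanishes.\<close>

lemma yd3_riemann:
  "yd j (yd l (yd m (spray_riemann i k))) x y =
     2 * yd k (berwald_deriv j i l m) x y - yd j (berwald_deriv k i l m) x y
     - yd l (berwald_deriv k i j m) x y - yd m (berwald_deriv k i j l) x y"
  unfolding spray_riemann_def berwald_deriv_def spray_cov_def
  by (simp add: yd_spray_deriv yd_xd yd_commute sum.distrib algebra_simps sum_subtractf sum_distrib_left)

end

section \<open>Contraction with a metric at one point\<close>

lemma sum_swap_pairs:
  "(\<Sum>a\<in>A. \<Sum>b\<in>B. \<Sum>c\<in>C. \<Sum>d\<in>D. X a b c d) = (\<Sum>c\<in>C. \<Sum>d\<in>D. \<Sum>a\<in>A. \<Sum>b\<in>B. X a b c d)"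
proof -
  have "(\<Sum>b\<in>B. \<Sum>c\<in>C. \<Sum>d\<in>D. X a b c d) = (\<Sum>c\<in>C. \<Sum>d\<in>D. \<Sum>b\<in>B. X a b c d)" for a
    by (subst sum.swap) (intro sum.cong refl sum.swap)
  then have "(\<Sum>a\<in>A. \<Sum>b\<in>B. \<Sum>c\<in>C. \<Sum>d\<in>D. X a b c d) = (\<Sum>a\<in>A. \<Sum>c\<in>C. \<Sum>d\<in>D. \<Sum>b\<in>B. X a b c d)"
    by simp
  also have "\<dots> = (\<Sum>c\<in>C. \<Sum>d\<in>D. \<Sum>a\<in>A. \<Sum>b\<in>B. X a b c d)"
    by (subst sum.swap) (intro sum.cong refl sum.swap)
  finally show ?thesis .
qed

text \<open>Linear algebra at a fixed \<open>(x, y)\<close>: a symmetric form with its inverse, the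
  lowered vector \<open>v\<close> and the squared length \<open>q\<close> of \<open>y\<close>. It
  will be applied to twice the fundamental tensor.\<close>

locale metric_contraction =
  fixes g gi :: "'n::finite \<Rightarrow> 'n \<Rightarrow> real" and y v :: "'n \<Rightarrow> real" and q :: real
  assumes g_sym: "g i j = g j i" and gi_sym: "gi i j = gi j i"
    and inv: "(\<Sum>j\<in>UNIV. gi i j * g j k) = (if i = k then 1 else 0)"
    and v_def: "v i = (\<Sum>j\<in>UNIV. g i j * y j)"
    and q_def: "q = (\<Sum>i\<in>UNIV. v i * y i)" and q_nz: "q \<noteq> 0"
begin

definition tr :: "('n \<Rightarrow> 'n \<Rightarrow> real) \<Rightarrow> real" where
  "tr X = (\<Sum>j\<in>UNIV. \<Sum>k\<in>UNIV. gi j k * X j k)"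

text \<open>The angular metric; removing the part along \<open>y\<close> makes its contraction with
  \<open>y\<close> vanish.\<close>

definition h :: "'n \<Rightarrow> 'n \<Rightarrow> real" where "h i j = g i j - v i * v j / q"

lemma h_sym: "h i j = h j i"
  by (simp add: h_def g_sym)

lemma gi_v: "(\<Sum>j\<in>UNIV. gi i j * v j) = y i"
proof -
  have "(\<Sum>j\<in>UNIV. gi i j * v j) = (\<Sum>j\<in>UNIV. \<Sum>k\<in>UNIV. gi i j * g j k * y k)"
    by (simp add: v_def sum_distrib_left mult.assoc)
  also have "\<dots> = (\<Sum>k\<in>UNIV. (\<Sum>j\<in>UNIV. gi i j * g j k) * y k)"
    by (subst sum.swap) (simp add: sum_distrib_right)
  also have "\<dots> = y i" by (simp add: inv if_distrib[where f = "\<lambda>t. t * _"] cong: if_cong)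
  finally show ?thesis .
qed

lemma tr_add: "tr (\<lambda>j k. X j k + Y j k) = tr X + tr Y"
  by (simp add: tr_def distrib_left sum.distrib)

lemma tr_diff: "tr (\<lambda>j k. X j k - Y j k) = tr X - tr Y"
  by (simp add: tr_def right_diff_distrib sum_subtractf)

lemma tr_cmult: "tr (\<lambda>j k. c * X j k) = c * tr X"
  by (simp add: tr_def sum_distrib_left mult.left_commute)

lemma tr_sum: "tr (\<lambda>j k. \<Sum>r\<in>A. X r j k) = (\<Sum>r\<in>A. tr (X r))"
proof -
  have "tr (\<lambda>j k. 0) = 0" by (simp add: tr_def)
  then show ?thesis by (induction A rule: infinite_finite_induct) (simp_all add: tr_add)
qed

lemma tr_transpose: "tr (\<lambda>j k. X k j) = tr X"
  unfolding tr_def by (subst sum.swap) (simp add: gi_sym)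

lemma tr_vec: "tr (\<lambda>j k. g l j * X k) = X l"
proof -
  have "tr (\<lambda>j k. g l j * X k) = (\<Sum>k\<in>UNIV. (\<Sum>j\<in>UNIV. gi k j * g j l) * X k)"
    unfolding tr_def by (subst sum.swap) (simp add: sum_distrib_right gi_sym[of _ k for k] g_sym[of l] mult.assoc)
  then show ?thesis by (simp add: inv if_distrib[where f = "\<lambda>t. t * _"] cong: if_cong)
qed

lemma tr_v: "tr (\<lambda>j k. v j * X k) = (\<Sum>k\<in>UNIV. X k * y k)"
proof -
  have "tr (\<lambda>j k. v j * X k) = (\<Sum>k\<in>UNIV. (\<Sum>j\<in>UNIV. gi k j * v j) * X k)"
    unfolding tr_def by (subst sum.swap) (simp add: sum_distrib_right gi_sym[of _ k for k] mult.assoc)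
  then show ?thesis unfolding gi_v by (simp add: mult.commute)
qed

text \<open>The term by which \<open>h\<close> differs from \<open>g\<close> contracts
  \<open>X\<close> with \<open>y\<close>, so here \<open>h\<close> acts like
  \<open>g\<close>.\<close>

lemma tr_h_vec:
  assumes "(\<Sum>k\<in>UNIV. X k * y k) = 0"
  shows "tr (\<lambda>j k. h l j * X k) = X l"
proof -
  have "tr (\<lambda>j k. h l j * X k) = tr (\<lambda>j k. g l j * X k - (v l / q) * (v j * X k))"
    by (simp add: h_def algebra_simps)
  then show ?thesis by (simp only: tr_diff tr_cmult tr_vec tr_v assms)
qed

lemma tr_g: "tr g = CARD('n)"
proof -
  have "tr g = (\<Sum>j\<in>UNIV. \<Sum>k\<in>UNIV. gi j k * g k j)"
    unfolding tr_def by (simp add: g_sym)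
  then show ?thesis by (simp add: inv)
qed

lemma tr_h: "tr h = real CARD('n) - 1"
proof -
  have "tr h = tr (\<lambda>j k. g j k - (1 / q) * (v j * v k))"
    by (simp add: h_def[abs_def])
  also have "\<dots> = real CARD('n) - (1 / q) * q"
    by (simp only: tr_diff tr_cmult tr_v tr_g q_def[symmetric])
  finally show ?thesis using q_nz by simp
qed

lemma inv': "(\<Sum>j\<in>UNIV. g i j * gi j k) = (if i = k then 1 else 0)"
  using inv[of k i] by (simp add: g_sym[of i] gi_sym[of _ k] mult.commute eq_commute)

text \<open>The hypothesis is the varied identity \<open>gi g = 1\<close>, with \<open>A\<close> and
  \<open>H\<close> the variations of \<open>gi\<close> and \<open>g\<close>; multiplying it by
  \<open>gi\<close> on the right isolates \<open>A\<close>.\<close>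

lemma inverse_variation:
  assumes "\<And>l m. (\<Sum>k\<in>UNIV. A l k * g k m + gi l k * H k m) = 0"
  shows "A l b = - (\<Sum>k\<in>UNIV. \<Sum>m\<in>UNIV. gi l k * H k m * gi m b)"
proof -
  have "A l b = (\<Sum>k\<in>UNIV. A l k * (\<Sum>m\<in>UNIV. g k m * gi m b))"
    by (simp add: inv' if_distrib[where f = "\<lambda>t. _ * t"] cong: if_cong)
  also have "\<dots> = (\<Sum>m\<in>UNIV. (\<Sum>k\<in>UNIV. A l k * g k m) * gi m b)"
    unfolding sum_distrib_left sum_distrib_right by (subst sum.swap) (simp add: mult.assoc)
  also have "\<dots> = (\<Sum>m\<in>UNIV. - (\<Sum>k\<in>UNIV. gi l k * H k m) * gi m b)"
  proof -
    have "(\<Sum>k\<in>UNIV. A l k * g k m) = - (\<Sum>k\<in>UNIV. gi l k * H k m)" for m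
      using assms[of l m] by (simp add: sum.distrib)
    then show ?thesis by simp
  qed
  also have "\<dots> = - (\<Sum>k\<in>UNIV. \<Sum>m\<in>UNIV. gi l k * H k m * gi m b)"
    unfolding sum_negf[symmetric] sum_distrib_right by (subst sum.swap) (simp add: sum_negf)
  finally show ?thesis .
qed

text \<open>Each side is minus the pairing of \<open>H\<close> and \<open>H'\<close> through two
  copies of \<open>gi\<close>, which is symmetric because \<open>gi\<close> is. It will identify two
  mixed derivatives of a logarithmic determinant.\<close>

lemma inverse_variation_symmetric:
  assumes "\<And>l m. (\<Sum>k\<in>UNIV. A l k * g k m + gi l k * H k m) = 0"
    and "\<And>l m. (\<Sum>k\<in>UNIV. A' l k * g k m + gi l k * H' k m) = 0"
  shows "(\<Sum>l\<in>UNIV. \<Sum>b\<in>UNIV. A l b * H' l b) = (\<Sum>l\<in>UNIV. \<Sum>b\<in>UNIV. A' l b * H l b)"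
proof -
  let ?X = "\<lambda>l b k m. gi l k * H k m * gi m b * H' l b"
  let ?Y = "\<lambda>l b k m. gi l k * H' k m * gi m b * H l b"
  have eq: "?X l b k m = ?Y k m l b" for l b k m
    by (simp add: gi_sym[of k l] gi_sym[of b m])
  have "(\<Sum>l\<in>UNIV. \<Sum>b\<in>UNIV. \<Sum>k\<in>UNIV. \<Sum>m\<in>UNIV. ?X l b k m)
      = (\<Sum>k\<in>UNIV. \<Sum>m\<in>UNIV. \<Sum>l\<in>UNIV. \<Sum>b\<in>UNIV. ?Y k m l b)"
    unfolding eq by (rule sum_swap_pairs)
  then show ?thesis
    by (simp add: inverse_variation[OF assms(1)] inverse_variation[OF assms(2)] sum_distrib_right sum_negf)
qed

end

text \<open>What the differential identities leave at one point: \<open>M\<close> is \<nabla> of the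
  Berwald curvature, \<open>E\<close> that of the mean Berwald curvature up to a factor, and
  \<open>C\<close> the Cartan tensor up to a factor. \<open>T\<close> gathers every multiple of
  \<open>y i\<close>, not only the tensor of the GDW equation.\<close>

locale gdw_algebra = metric_contraction g gi y v q
  for g gi :: "'n::finite \<Rightarrow> 'n \<Rightarrow> real" and y v q +
  fixes E :: "'n \<Rightarrow> 'n \<Rightarrow> real" and C T :: "'n \<Rightarrow> 'n \<Rightarrow> 'n \<Rightarrow> real"
    and M :: "'n \<Rightarrow> 'n \<Rightarrow> 'n \<Rightarrow> 'n \<Rightarrow> real"
  assumes E_sym: "E j k = E k j" and E_y: "(\<Sum>k\<in>UNIV. E j k * y k) = 0"
    and M_eq: "M j i k l = T j k l * y i + (if l = i then 1 else 0) * E j k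
        + (if j = i then 1 else 0) * E k l + (if k = i then 1 else 0) * E l j"
    and v_M: "(\<Sum>i\<in>UNIV. v i * M j i k l) = 0"
    and g_M: "(\<Sum>i\<in>UNIV. g m i * M j i k l) = (\<Sum>i\<in>UNIV. g l i * M j i k m)"
    and C_sym: "C i j k = C j i k" "C i j k = C i k j"
    and C_y: "(\<Sum>k\<in>UNIV. C i j k * y k) = 0"
    and C_M: "(\<Sum>i\<in>UNIV. C i m l * M j i s k) - (\<Sum>i\<in>UNIV. C i m k * M j i s l) =
        (\<Sum>i\<in>UNIV. C i j l * M m i s k) - (\<Sum>i\<in>UNIV. C i j k * M m i s l)"
    and dim: "CARD('n) > 2"
begin

definition lam :: real where "lam = tr E / (real CARD('n) - 1)"

lemma contract_M:
  "(\<Sum>i\<in>UNIV. X i * M j i k l) =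
    T j k l * (\<Sum>i\<in>UNIV. X i * y i) + X l * E j k + X j * E k l + X k * E l j"
  by (simp add: M_eq distrib_left sum.distrib sum_distrib_left mult.left_commute
      if_distrib[where f = "\<lambda>t. t * _"] if_distrib[where f = "\<lambda>t. _ * t"] cong: if_cong)

text \<open>Contraction with \<open>v\<close> annihilates \<open>M\<close> and multiplies
  \<open>T\<close> by the nonzero \<open>q\<close>, so \<open>T\<close> can be solved for.\<close>

lemma T_eq: "T j k l = - (v l * E j k + v j * E k l + v k * E l j) / q"
  using v_M[of j k l] q_nz by (simp add: contract_M q_def[symmetric] field_simps)

lemma g_M_eq: "(\<Sum>i\<in>UNIV. g m i * M j i k l) = h m l * E j k + h m j * E k l + h m k * E l j"
  unfolding contract_M v_def[symmetric] T_eq h_def using q_nz by (simp add: field_simps)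

text \<open>Symmetry of the lowered \<open>M\<close> in its first and last index cancels the common
  term \<open>h m l * E j k\<close>. The trace over \<open>m\<close>, \<open>j\<close> of what
  remains reads \<open>(n - 1) E + E = E + (tr E) h\<close>.\<close>

lemma E_h: "E k l = lam * h k l"
proof -
  have eq: "h m j * E k l + h m k * E l j = h l j * E k m + h l k * E m j" for m j
    using g_M[of m j k l] unfolding g_M_eq by (simp add: h_sym)
  have "tr (\<lambda>m j. E k l * h m j + h k m * E l j) = tr (\<lambda>m j. h l j * E k m + h k l * E m j)"
    using eq by (simp add: h_sym mult.commute)
  then have "E k l * tr h + tr (\<lambda>m j. h k m * E l j) = tr (\<lambda>m j. h l j * E k m) + h k l * tr E"
    by (simp add: tr_add tr_cmult)
  moreover have "tr (\<lambda>m j. h k m * E l j) = E k l"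
    using tr_h_vec[OF E_y[of l], of k] unfolding E_sym[of l k] .
  moreover have "tr (\<lambda>m j. h l j * E k m) = E k l"
    using tr_h_vec[OF E_y[of k], of l] tr_transpose[of "\<lambda>j m. h l j * E k m"] by (simp only:)
  ultimately show ?thesis using dim by (simp add: tr_h lam_def field_simps)
qed

text \<open>The \<open>T\<close> term of \<open>M\<close> disappears since \<open>C\<close>
  annihilates \<open>y\<close>; the rest follows from \<open>E = lam * h\<close>.\<close>

lemma contract_C_M: "(\<Sum>i\<in>UNIV. C i m l * M j i s k) =
    lam * (C m l k * h j s + C m l j * h s k + C m l s * h k j)"
proof -
  have "C i m l = C m l i" for i using C_sym by metis
  then have "(\<Sum>i\<in>UNIV. C i m l * y i) = 0" using C_y[of m l] by simp
  moreover have "C l m l = C m l l" "C j m l = C m l j" "C s m l = C m l s" "C k m l = C m l k"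
    using C_sym by metis+
  ultimately show ?thesis
    unfolding contract_M E_h[of j s] E_h[of s k] E_h[of k j] by (simp add: algebra_simps)
qed

lemma lam_C: "lam * tr (\<lambda>j k. C j k l) = 0"
proof -
  have C_perm: "C i j k = C j i k" "C i j k = C k j i" "C i j k = C i k j" "C i j k = C j k i" "C i j k = C k i j"
    for i j k using C_sym by metis+
  \<comment> \<open>The terms of \<open>C_M\<close> in which \<open>s\<close> is an index of
    \<open>h\<close> all cancel; those with \<open>s\<close> on \<open>C\<close> remain.\<close>
  have eq: "lam * (C m l s * h k j) - lam * (C m k s * h l j) =
      lam * (C j l s * h k m) - lam * (C j k s * h l m)" for m s k j l
  proof -
    have "C m l k = C m k l" "C j l k = C j k l" "C m l j = C j l m" "C m k j = C j k m" 
      using C_perm by metis+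
    then show ?thesis
      using C_M[of m l j s k] unfolding contract_C_M by (simp add: algebra_simps h_sym)
  qed
  \<comment> \<open>Trace over \<open>k\<close>, \<open>j\<close>: the factor \<open>n - 3\<close>
    is the trace \<open>n - 1\<close> of \<open>h\<close> less one copy of \<open>C\<close> from
    either side.\<close>
  have eq2: "lam * ((real CARD('n) - 3) * C m l s + h l m * tr (\<lambda>j k. C j k s)) = 0" for m s l
  proof -
    have "tr (\<lambda>k j. lam * (C m l s * h k j) - lam * (h l j * C m k s)) =
        tr (\<lambda>k j. lam * (h m k * C j l s) - lam * (h l m * C j k s))"
      using eq[of m l s] by (simp add: h_sym mult.commute mult.left_commute)
    then have "lam * (C m l s * tr h) - lam * tr (\<lambda>k j. h l j * C m k s) =
        lam * tr (\<lambda>k j. h m k * C j l s) - lam * (h l m * tr (\<lambda>k j. C j k s))"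
      by (simp add: tr_diff tr_cmult)
    moreover have "tr (\<lambda>k j. h l j * C m k s) = C m l s"
    proof -
      have "(\<Sum>k\<in>UNIV. C m k s * y k) = 0"
        using C_y[of m s] by (simp add: C_sym(2)[of m _ s])
      from tr_h_vec[OF this, of l] show ?thesis
        using tr_transpose[of "\<lambda>j k. h l j * C m k s"] by (simp only:)
    qed
    moreover have "tr (\<lambda>k j. h m k * C j l s) = C m l s"
    proof -
      have "(\<Sum>j\<in>UNIV. C j l s * y j) = 0"
        using C_y[of l s] by (simp add: C_perm(4)[of _ l s])
      from tr_h_vec[OF this, of m] show ?thesis by (simp only:)
    qed
    moreover have "tr (\<lambda>k j. C j k s) = tr (\<lambda>j k. C j k s)"
      using C_sym by simp
    ultimately show ?thesis by (simp add: tr_h algebra_simps)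
  qed
  \<comment> \<open>The trace of \<open>C\<close> annihilates \<open>y\<close>, as
    \<open>tr_h_vec\<close> requires for the second trace.\<close>
  have y_tr: "(\<Sum>s\<in>UNIV. tr (\<lambda>j k. C j k s) * y s) = 0"
  proof -
    have "(\<Sum>s\<in>UNIV. tr (\<lambda>j k. C j k s) * y s) = tr (\<lambda>j k. \<Sum>s\<in>UNIV. C j k s * y s)"
      unfolding tr_def sum_distrib_left sum_distrib_right
      by (subst sum.swap, rule sum.cong[OF refl], subst sum.swap) (simp add: mult.assoc)
    then show ?thesis by (simp add: C_y tr_def)
  qed
  \<comment> \<open>Second trace, over \<open>m\<close> and \<open>s\<close>:
    \<open>(n - 3) + 1 = n - 2\<close>, a nonzero factor by \<open>dim\<close>.\<close>
  have "tr (\<lambda>m s. lam * ((real CARD('n) - 3) * C m l s + h l m * tr (\<lambda>j k. C j k s))) = 0"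
    unfolding eq2 by (simp add: tr_def)
  then have "lam * ((real CARD('n) - 3) * tr (\<lambda>m s. C m l s) + tr (\<lambda>j k. C j k l)) = 0"
    by (simp only: tr_cmult tr_add tr_h_vec[OF y_tr])
  moreover have "tr (\<lambda>m s. C m l s) = tr (\<lambda>j k. C j k l)"
    using C_sym by simp
  ultimately have "lam * ((real CARD('n) - 2) * tr (\<lambda>j k. C j k l)) = 0"
    by (simp add: algebra_simps)
  then show ?thesis using dim by auto
qed

lemma M_eq_0: "lam = 0 \<Longrightarrow> M j i k l = 0"
  by (simp add: M_eq T_eq E_h[of j k] E_h[of k l] E_h[of l j])

end

section \<open>Finsler metrics in a chart\<close>

lemma matrix_inv_mult:
  fixes A :: "real ^ 'n::finite ^ 'n"
  assumes "det A \<noteq> 0"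
  shows "A ** matrix_inv A = mat 1" "matrix_inv A ** A = mat 1"
proof -
  have "invertible A" using assms invertible_det_nz by blast
  then have "\<exists>B. A ** B = mat 1 \<and> B ** A = mat 1" by (simp add: invertible_def)
  then show "A ** matrix_inv A = mat 1" "matrix_inv A ** A = mat 1"
    unfolding matrix_inv_def by (metis (mono_tags, lifting) someI_ex)+
qed

text \<open>Cramer's rule for the \<open>j\<close>-th column of the inverse. Quotients of
  determinants make it visible that the entries of the inverse metric are smooth.\<close>

lemma matrix_inv_nth:
  fixes A :: "real ^ 'n::finite ^ 'n"
  assumes "det A \<noteq> 0"
  shows "matrix_inv A $ i $ j = det (\<chi> a b. if b = i then axis j 1 $ a else A $ a $ b) / det A"
proof -
  have "A *v (matrix_inv A *v axis j 1) = axis j 1"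
    by (simp only: matrix_vector_mul_assoc matrix_inv_mult[OF assms] matrix_vector_mul_lid)
  then have "matrix_inv A *v axis j 1 = (\<chi> k. det (\<chi> a b. if b = k then axis j 1 $ a else A $ a $ b) / det A)"
    unfolding cramer[OF assms] .
  then have "(matrix_inv A *v axis j 1) $ i = det (\<chi> a b. if b = i then axis j 1 $ a else A $ a $ b) / det A"
    by simp
  then show ?thesis by (simp add: matrix_vector_mult_basis column_def)
qed

section \<open>Fundamental tensor, its inverse and the spray in a chart\<close>

locale chart_metric = open_region U for U :: "(real ^ 'n::finite) set" +
  fixes L :: "'n coord_fun"
  assumes sm_L: "smooth_expr U L"
    and hom_L: "hom 1 L"
    and pos: "x \<in> U \<Longrightarrow> y \<noteq> 0 \<Longrightarrow> u \<noteq> 0 \<Longrightarrow>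
      (\<Sum>i\<in>UNIV. \<Sum>j\<in>UNIV. fund_tensor L i j x y * (u :: real ^ 'n) $ i * u $ j) > 0"
begin

abbreviation Q :: "'n coord_fun" where "Q \<equiv> sq L"

lemma sm_Q [simp, intro]: "sm Q"
  unfolding sq_def using sm_L by auto

lemma hom_Q: "hom 2 Q"
  using hom_L by (simp add: sq_def hom_def power_mult_distrib)

definition gmat :: "real ^ 'n \<Rightarrow> real ^ 'n \<Rightarrow> real ^ 'n ^ 'n" where
  "gmat x y = (\<chi> a b. fund_tensor L a b x y)"

lemma sm_fund: "sm (fund_tensor L i j)"
  unfolding fund_tensor_def by auto

lemma fund_eq: "x \<in> U \<Longrightarrow> y \<noteq> 0 \<Longrightarrow> fund_tensor L i j x y = 1/2 * yd i (yd j Q) x y"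
  using yd_cong[of "yd j Q" "dy j Q" i]
  by (simp add: fund_tensor_def yd_def[of i "dy j Q"] yd_eq[of _ _ j])

lemma fund_sym: "x \<in> U \<Longrightarrow> y \<noteq> 0 \<Longrightarrow> fund_tensor L i j x y = fund_tensor L j i x y"
  by (simp add: fund_eq yd_commute)

lemma det_gmat: 
  assumes "x \<in> U" "y \<noteq> 0"
  shows "det (gmat x y) \<noteq> 0"
proof -
  have "u = 0" if "gmat x y *v u = 0" for u
  proof (rule ccontr)
    assume "u \<noteq> 0"
    from pos[OF assms this] have "u \<bullet> (gmat x y *v u) > 0"
      by (simp add: gmat_def matrix_vector_mult_def inner_vec_def sum_distrib_left mult_ac)
    then show False using that by simp
  qed
  then show ?thesis
    using matrix_left_invertible_ker invertible_left_inverse invertible_det_nz by blast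
qed

lemma sm_det:
  assumes "\<And>i j. sm (\<lambda>x y. f x y $ i $ j)"
  shows "sm (\<lambda>x y. det (f x y :: real ^ 'n ^ 'n))"
  unfolding det_def using assms by auto

lemma sm_fund_inv: "sm (fund_tensor_inv L i j)"
proof (rule smooth_expr_cong[OF open_U])
  show "sm (\<lambda>x y. det (\<chi> a b. if b = i then axis j 1 $ a else gmat x y $ a $ b) / det (gmat x y))"
    using sm_fund by (intro sm_divide sm_det det_gmat) (auto simp: gmat_def axis_def)
qed (simp add: fund_tensor_inv_def gmat_def[symmetric] matrix_inv_nth[OF det_gmat])

lemma fund_mult_inv:
  assumes "x \<in> U" "y \<noteq> 0"
  shows "(\<Sum>j\<in>UNIV. fund_tensor L i j x y * fund_tensor_inv L j k x y) = (if i = k then 1 else 0)"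
    and "(\<Sum>j\<in>UNIV. fund_tensor_inv L i j x y * fund_tensor L j k x y) = (if i = k then 1 else 0)"
proof -
  have "(gmat x y ** matrix_inv (gmat x y)) $ i $ k = (if i = k then 1 else 0)"
    "(matrix_inv (gmat x y) ** gmat x y) $ i $ k = (if i = k then 1 else 0)"
    using matrix_inv_mult[OF det_gmat[OF assms]] by (simp_all add: mat_def)
  then show "(\<Sum>j\<in>UNIV. fund_tensor L i j x y * fund_tensor_inv L j k x y) = (if i = k then 1 else 0)"
    "(\<Sum>j\<in>UNIV. fund_tensor_inv L i j x y * fund_tensor L j k x y) = (if i = k then 1 else 0)"
    by (simp_all add: matrix_matrix_mult_def fund_tensor_inv_def gmat_def)
qed

lemma fund_inv_sym:
  assumes "x \<in> U" "y \<noteq> 0"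
  shows "fund_tensor_inv L i j x y = fund_tensor_inv L j i x y"
proof -
  let ?A = "gmat x y" and ?B = "matrix_inv (gmat x y)"
  have A: "transpose ?A = ?A" using fund_sym[OF assms] by (simp add: gmat_def transpose_def vec_eq_iff)
  have "transpose (?B ** ?A) = mat 1" by (simp add: matrix_inv_mult[OF det_gmat[OF assms]])
  then have "?A ** transpose ?B = mat 1" by (simp add: matrix_transpose_mul A)
  then have "?B = ?B ** (?A ** transpose ?B)" by simp
  also have "\<dots> = transpose ?B" by (simp add: matrix_mul_assoc matrix_inv_mult[OF det_gmat[OF assms]])
  finally have "?B $ i $ j = transpose ?B $ i $ j" by simp
  then show ?thesis by (simp add: transpose_def fund_tensor_inv_def gmat_def)
qed

lemma sm_spray: "sm (spray L i)"
  unfolding spray_def using sm_fund_inv by auto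

sublocale spray_region U "spray L"
  by unfold_locales (rule sm_spray)

lemma hom_fund_inv: "hom 0 (fund_tensor_inv L i j)"
proof (rule homI)
  fix x y :: "real ^ 'n" and a :: real
  assume xy: "x \<in> U" "y \<noteq> 0" "a > 0"
  have "hom 1 (dy j Q)" for j by (rule hom_dy) (use hom_Q in \<open>auto simp: numeral_2_eq_2\<close>)
  then have "hom 0 (dy i (dy j Q))" for i j by (intro hom_dy[of "dy j Q"]) auto
  then have "fund_tensor L i j x (a *\<^sub>R y) = fund_tensor L i j x y" for i j
    using xy homD[of 0] by (simp add: fund_tensor_def)
  then show "fund_tensor_inv L i j x (a *\<^sub>R y) = a ^ 0 * fund_tensor_inv L i j x y"
    by (simp add: fund_tensor_inv_def)
qed

lemma hom_spray: "hom 2 (spray L i)"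
proof -
  have "hom 1 (dx k (dy l Q))" for k l
    by (intro hom_dx hom_dy) (use hom_Q in \<open>auto simp: numeral_2_eq_2\<close>)
  then have "hom (1 + 1) (\<lambda>x y. dx k (dy l Q) x y * y $ k)" for k l
    by (intro hom_mult hom_y)
  moreover have "hom 2 (dx l Q)" for l by (intro hom_dx hom_Q) auto
  ultimately have "hom 2 (\<lambda>x y. (\<Sum>k\<in>UNIV. dx k (dy l Q) x y * y $ k) - dx l Q x y)" for l
    by (intro hom_diff hom_sum) (auto simp: numeral_2_eq_2)
  then have "hom (0 + 2) (\<lambda>x y. fund_tensor_inv L i l x y *
      ((\<Sum>k\<in>UNIV. dx k (dy l Q) x y * y $ k) - dx l Q x y))" for l
    by (intro hom_mult hom_fund_inv)
  then show ?thesis unfolding spray_def by (intro hom_cmult hom_sum) (simp only: add_0)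
qed

text \<open>The definition of the spray with the inverse metric moved to the other side;
  \<open>yd k (yd i Q)\<close> is twice the fundamental tensor, hence a factor 2 instead of
  4.\<close>

lemma geodesic_eq:
  assumes xy: "x \<in> U" "y \<noteq> 0"
  shows "2 * (\<Sum>i\<in>UNIV. yd k (yd i Q) x y * spray L i x y)
    = (\<Sum>m\<in>UNIV. y $ m * xd m (yd k Q) x y) - xd k Q x y"
proof -
  define W where "W l = (\<Sum>m\<in>UNIV. y $ m * xd m (yd l Q) x y) - xd l Q x y" for l
  have "xd m (yd l Q) x y = dx m (dy l Q) x y" for m l
    using xd_cong[of "yd l Q" "dy l Q" m] xy by (simp add: xd_def[of m "dy l Q"] yd_eq[of _ _ l])
  then have "spray L i x y = 1/4 * (\<Sum>l\<in>UNIV. fund_tensor_inv L i l x y * W l)" for i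
    using xy by (simp add: spray_def W_def xd_eq mult.commute)
  then have "2 * (\<Sum>i\<in>UNIV. yd k (yd i Q) x y * spray L i x y) =
      (\<Sum>i\<in>UNIV. \<Sum>l\<in>UNIV. fund_tensor L k i x y * fund_tensor_inv L i l x y * W l)"
    using xy by (simp add: fund_eq sum_distrib_left mult_ac)
  also have "\<dots> = (\<Sum>l\<in>UNIV. (\<Sum>i\<in>UNIV. fund_tensor L k i x y * fund_tensor_inv L i l x y) * W l)"
    by (subst sum.swap) (simp add: sum_distrib_right)
  also have "\<dots> = W k"
    using xy by (simp add: fund_mult_inv if_distrib[where f = "\<lambda>t. t * _"] cong: if_cong)
  finally show ?thesis by (simp add: W_def)
qed

lemma hom_yd_Q: "hom 1 (yd k Q)"
  by (rule hom_yd) (use hom_Q in \<open>auto simp: numeral_2_eq_2\<close>)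

text \<open>Euler-Lagrange equation of the energy \<open>Q\<close>.\<close>

lemma spray_deriv_yd_Q: "spray_deriv (yd l Q) = xd l Q"
proof (intro ext)
  fix x y
  show "spray_deriv (yd l Q) x y = xd l Q x y"
  proof (cases "x \<in> U \<and> y \<noteq> 0")
    case True
    then show ?thesis
      using geodesic_eq[of x y l] by (simp add: spray_deriv_def yd_commute mult.commute)
  qed simp
qed

text \<open>Conservation of energy: contract the Euler-Lagrange equation with \<open>y\<close> and
  evaluate by Euler's identity for \<open>yd k Q\<close> of degree 1 and \<open>xd k Q\<close> of
  degree 2.\<close>

lemma spray_deriv_Q: "spray_deriv Q = (\<lambda>x y. 0)"
proof (intro ext)
  fix x y
  show "spray_deriv Q x y = 0"
  proof (cases "x \<in> U \<and> y \<noteq> 0")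
    case True
    have e1: "(\<Sum>l\<in>UNIV. y $ l * yd k (yd l Q) x y) = yd k Q x y" for k
      using euler_yd[OF _ hom_yd_Q[of k], of x y] True by (simp add: yd_commute)
    have e2: "(\<Sum>l\<in>UNIV. y $ l * xd k (yd l Q) x y) = 2 * xd k Q x y" for k
      using euler_yd[OF _ hom_xd[OF _ hom_Q], of k x y] True by (simp add: yd_xd)
    have "(\<Sum>l\<in>UNIV. y $ l * xd l Q x y) = (\<Sum>l\<in>UNIV. y $ l * spray_deriv (yd l Q) x y)"
      by (simp add: spray_deriv_yd_Q)
    also have "\<dots> = (\<Sum>l\<in>UNIV. \<Sum>k\<in>UNIV. y $ k * (y $ l * xd k (yd l Q) x y)) -
        2 * (\<Sum>l\<in>UNIV. \<Sum>k\<in>UNIV. spray L k x y * (y $ l * yd k (yd l Q) x y))"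
      by (simp add: spray_deriv_def right_diff_distrib sum_subtractf sum_distrib_left mult_ac)
    also have "\<dots> = (\<Sum>k\<in>UNIV. y $ k * (2 * xd k Q x y)) - 2 * (\<Sum>k\<in>UNIV. spray L k x y * yd k Q x y)"
    proof -
      have "(\<Sum>l\<in>UNIV. \<Sum>k\<in>UNIV. y $ k * (y $ l * xd k (yd l Q) x y)) = (\<Sum>k\<in>UNIV. y $ k * (2 * xd k Q x y))"
        by (subst sum.swap) (simp only: sum_distrib_left[symmetric] e2)
      moreover have "(\<Sum>l\<in>UNIV. \<Sum>k\<in>UNIV. spray L k x y * (y $ l * yd k (yd l Q) x y))
          = (\<Sum>k\<in>UNIV. spray L k x y * yd k Q x y)"
        by (subst sum.swap) (simp only: sum_distrib_left[symmetric] e1)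
      ultimately show ?thesis by simp
    qed
    finally show ?thesis
      by (simp add: spray_deriv_def sum_distrib_left[symmetric] mult.left_commute[of _ 2])
  qed simp
qed

text \<open>\<open>Q\<close> is horizontally constant: in the vertical derivative of
  \<open>spray_deriv Q = 0\<close> the commutator and the Euler-Lagrange equation each contribute
  one \<open>xd j Q\<close>, against \<open>2 N^r_j yd r Q\<close>.\<close>

lemma xd_Q: "xd j Q = (\<lambda>x y. \<Sum>r\<in>UNIV. N r j x y * yd r Q x y)"
proof -
  have "yd j (spray_deriv Q) = (\<lambda>x y. 0)" by (simp add: spray_deriv_Q)
  then show ?thesis
    unfolding yd_spray_deriv[OF sm_Q] spray_deriv_yd_Q by (simp add: fun_eq_iff)
qed

lemma xd_yd_Q: "xd j (yd k Q) = (\<lambda>x y. \<Sum>r\<in>UNIV. yd j (yd k (spray L r)) x y * yd r Q x y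
    + N r j x y * yd k (yd r Q) x y)"
  using arg_cong[OF xd_Q[of j], of "yd k"] by (simp add: yd_xd yd_commute)

text \<open>The metric is parallel along \<open>y\<close>, by a vertical derivative of the
  Euler-Lagrange equation.\<close>

lemma spray_deriv_yd2_Q: "spray_deriv (yd j (yd k Q)) = (\<lambda>x y. \<Sum>r\<in>UNIV.
    N r j x y * yd r (yd k Q) x y + N r k x y * yd r (yd j Q) x y)"
  using arg_cong[OF spray_deriv_yd_Q[of j], of "yd k"]
  by (simp add: yd_spray_deriv yd_xd xd_yd_Q yd_commute fun_eq_iff sum.distrib algebra_simps)

end

section \<open>Landsberg metrics of generalized Douglas-Weyl type\<close>

locale gdw_landsberg = chart_metric U L for U :: "(real ^ 'n::finite) set" and L :: "'n coord_fun" +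
  fixes T :: "'n \<Rightarrow> 'n \<Rightarrow> 'n \<Rightarrow> 'n coord_fun"
  assumes dim: "CARD('n) > 2"
    and landsberg_0: "x \<in> U \<Longrightarrow> y \<noteq> 0 \<Longrightarrow> landsberg L j k l x y = 0"
    and gdw: "x \<in> U \<Longrightarrow> y \<noteq> 0 \<Longrightarrow>
      (\<Sum>m\<in>UNIV. hcov13 L (douglas L) j i k l m x y * y $ m) = T j k l x y * y $ i"
begin

text \<open>In terms of the fundamental tensor and the Cartan tensor, \<open>q = 2 g\<close> and \<open>c = 4 C\<close>.\<close>

abbreviation q :: "'n \<Rightarrow> 'n \<Rightarrow> 'n coord_fun" where "q i j \<equiv> yd i (yd j Q)"
abbreviation c :: "'n \<Rightarrow> 'n \<Rightarrow> 'n \<Rightarrow> 'n coord_fun" where "c i j k \<equiv> yd i (yd j (yd k Q))"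

section \<open>Symmetries forced by vanishing Landsberg curvature\<close>

lemma q_y: "x \<in> U \<Longrightarrow> y \<noteq> 0 \<Longrightarrow> (\<Sum>m\<in>UNIV. q i m x y * y $ m) = yd i Q x y"
  using euler_yd[OF _ hom_yd_Q[of i], of x y] by (simp add: yd_commute mult.commute)

text \<open>The lowered \<open>y\<close> is half of \<open>yd r Q\<close>, so this contraction is
  the Landsberg curvature up to a factor.\<close>

lemma Q_B: "(\<Sum>r\<in>UNIV. yd r Q x y * B j r k l x y) = 0"
proof (cases "x \<in> U \<and> y \<noteq> 0")
  case True
  have y_low: "y_low L i x y = 1/2 * yd i Q x y" for i
    using True q_y[of x y i] by (simp add: y_low_def fund_eq sum_divide_distrib[symmetric])
  then have "landsberg L j k l x y = - 1/4 * (\<Sum>r\<in>UNIV. yd r Q x y * B j r k l x y)"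
    unfolding landsberg_def y_low berwald_def
    using True by (simp add: yd3_eq sm_spray sum_distrib_left sum_divide_distrib)
  then show ?thesis using landsberg_0[of x y] True by simp
qed simp

text \<open>Vertical derivative of \<open>Q_B\<close>. It trades the lowered curvature for a
  contraction of fourth vertical derivatives of the spray, which is symmetric in \<open>m\<close>,
  \<open>j\<close>, \<open>k\<close>, \<open>l\<close>.\<close>

lemma q_B: "(\<Sum>i\<in>UNIV. q m i x y * B j i k l x y) = - (\<Sum>r\<in>UNIV. yd r Q x y * yd m (B j r k l) x y)"
proof -
  have "(\<lambda>x y. \<Sum>r\<in>UNIV. yd r Q x y * B j r k l x y) = (\<lambda>x y. 0)"
    using Q_B by (simp add: fun_eq_iff)
  from fun_cong[OF fun_cong[OF arg_cong[OF this, of "yd m"], of x], of y]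
  show ?thesis by (simp add: sum.distrib)
qed

text \<open>The horizontal derivative of the metric vanishes in every direction, not only along
  \<open>y\<close>: in the vertical derivative of \<open>xd_yd_Q\<close> the third derivatives of
  the spray drop out by \<open>Q_B\<close>.\<close>

lemma xd_q: "xd j (q k l) x y = (\<Sum>r\<in>UNIV. yd j (yd k (spray L r)) x y * q r l x y
    + yd j (yd l (spray L r)) x y * q r k x y + N r j x y * c r k l x y)"
proof -
  have "(\<Sum>r\<in>UNIV. yd r Q x y * yd a (yd b (yd d (spray L r))) x y) = 0" for a b d
    by (rule Q_B)
  moreover have "(\<Sum>r\<in>UNIV. yd a (yd b (yd d (spray L r))) x y * yd r Q x y) = 0" for a b d
    using Q_B by (simp add: mult.commute)
  ultimately show ?thesis
    using fun_cong[OF fun_cong[OF arg_cong[OF xd_yd_Q[of j k], of "yd l"], of x], of y]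
    by (simp add: yd_xd yd_commute sum.distrib algebra_simps)
qed

text \<open>The Cartan tensor is parallel along \<open>y\<close>: differentiate \<nabla>
  \<open>g = 0\<close> vertically and evaluate the \<open>x\<close>-derivative produced by the
  commutator with \<open>xd_q\<close>.\<close>

lemma spray_deriv_c: "spray_deriv (c j k l) x y = (\<Sum>r\<in>UNIV. N r j x y * c r k l x y
    + N r k x y * c j r l x y + N r l x y * c j k r x y)"
  using fun_cong[OF fun_cong[OF arg_cong[OF spray_deriv_yd2_Q[of j k], of "yd l"], of x], of y]
  by (simp add: yd_spray_deriv xd_q yd_commute sum.distrib algebra_simps)

definition lowB :: "'n \<Rightarrow> 'n \<Rightarrow> 'n \<Rightarrow> 'n \<Rightarrow> 'n coord_fun" where
  "lowB m j k l = (\<lambda>x y. \<Sum>i\<in>UNIV. q m i x y * B j i k l x y)"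

lemma lowB_sym: "lowB m j k l = lowB j m k l" "lowB m j k l = lowB m k j l" "lowB m j k l = lowB m j l k"
  unfolding lowB_def q_B by (simp_all add: yd_commute)

text \<open>Lowering an index commutes with \<nabla> because the metric is parallel; the right side
  is \<nabla> of \<open>lowB\<close>.\<close>

lemma q_M: "(\<Sum>i\<in>UNIV. q m i x y * berwald_deriv j i k l x y) = spray_deriv (lowB m j k l) x y
    - (\<Sum>r\<in>UNIV. N r m x y * lowB r j k l x y + N r j x y * lowB m r k l x y
        + N r k x y * lowB m j r l x y + N r l x y * lowB m j k r x y)"
proof -
  have "(\<Sum>i\<in>UNIV. (spray_deriv (q m i) x y - (\<Sum>r\<in>UNIV. N r i x y * q m r x y)) * B j i k l x y)
      = (\<Sum>i\<in>UNIV. \<Sum>r\<in>UNIV. N r m x y * (q r i x y * B j i k l x y))"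
    by (simp add: spray_deriv_yd2_Q yd_commute sum.distrib algebra_simps sum_distrib_left)
  also have "\<dots> = (\<Sum>r\<in>UNIV. N r m x y * lowB r j k l x y)"
    unfolding lowB_def sum_distrib_left by (rule sum.swap)
  finally show ?thesis
    using contract_berwald_deriv[of "\<lambda>i. q m i" x y j k l]
    by (simp add: lowB_def sum.distrib del: spray_deriv_sum spray_deriv_mult)
qed

lemma q_M_sym: "(\<Sum>i\<in>UNIV. q m i x y * berwald_deriv j i k l x y) = (\<Sum>i\<in>UNIV. q l i x y * berwald_deriv j i k m x y)"
proof -
  have s: "lowB m j k l = lowB l j k m" for m j k l
    using lowB_sym by metis
  show ?thesis
    unfolding q_M s[of m] s[of _ j k l] by (simp add: sum.distrib)
qed

section \<open>Contractions of the Cartan tensor with the Berwald curvature\<close>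

definition cB :: "'n \<Rightarrow> 'n \<Rightarrow> 'n \<Rightarrow> 'n \<Rightarrow> 'n \<Rightarrow> 'n coord_fun" where
  "cB m l j s k = (\<lambda>x y. \<Sum>i\<in>UNIV. c i m l x y * B j i s k x y)"

definition Z :: "'n \<Rightarrow> 'n \<Rightarrow> 'n \<Rightarrow> 'n \<Rightarrow> 'n \<Rightarrow> 'n coord_fun" where
  "Z m j s k l = (\<lambda>x y. cB m l j s k x y - cB m k j s l x y)"

lemma sm_cB [simp]: "sm (cB m l j s k)"
  unfolding cB_def by auto

text \<open>In \<open>yd l (lowB m j s k)\<close> the part that differentiates \<open>B\<close> is
  symmetric in \<open>k\<close>, \<open>l\<close>, so the difference over \<open>k\<close>,
  \<open>l\<close> keeps only the terms with \<open>c\<close>, which form \<open>Z\<close>; and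
  \<open>lowB\<close> is symmetric in \<open>m\<close>, \<open>j\<close>.\<close>

lemma Z_sym: "Z m j s k l = Z j m s k l"
proof -
  have "Z m j s k l = (\<lambda>x y. yd l (lowB m j s k) x y - yd k (lowB m j s l) x y)" for m j
    unfolding Z_def cB_def lowB_def by (simp add: yd_commute sum.distrib fun_eq_iff)
  then show ?thesis using lowB_sym(1)[of m j] by simp
qed

lemma c_M: "(\<Sum>i\<in>UNIV. c i m l x y * berwald_deriv j i s k x y) = spray_deriv (cB m l j s k) x y
    - (\<Sum>r\<in>UNIV. N r m x y * cB r l j s k x y + N r l x y * cB m r j s k x y + N r j x y * cB m l r s k x y
        + N r s x y * cB m l j r k x y + N r k x y * cB m l j s r x y)"
proof -
  have "(\<Sum>i\<in>UNIV. (spray_deriv (c i m l) x y - (\<Sum>r\<in>UNIV. N r i x y * c r m l x y)) * B j i s k x y)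
      = (\<Sum>i\<in>UNIV. \<Sum>r\<in>UNIV. N r m x y * (c i r l x y * B j i s k x y) + N r l x y * (c i m r x y * B j i s k x y))"
    by (simp add: spray_deriv_c sum.distrib algebra_simps sum_distrib_left)
  also have "\<dots> = (\<Sum>r\<in>UNIV. N r m x y * cB r l j s k x y + N r l x y * cB m r j s k x y)"
    unfolding cB_def sum_distrib_left sum.distrib[symmetric] by (rule sum.swap)
  finally show ?thesis
    using contract_berwald_deriv[of "\<lambda>i. c i m l" x y j s k]
    by (simp add: cB_def sum.distrib del: spray_deriv_sum spray_deriv_mult)
qed

lemma c_M_Z: "(\<Sum>i\<in>UNIV. c i m l x y * berwald_deriv j i s k x y) - (\<Sum>i\<in>UNIV. c i m k x y * berwald_deriv j i s l x y)
    = spray_deriv (Z m j s k l) x y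
    - (\<Sum>r\<in>UNIV. N r m x y * Z r j s k l x y + N r j x y * Z m r s k l x y + N r s x y * Z m j r k l x y
        + N r l x y * Z m j s k r x y + N r k x y * Z m j s r l x y)"
  unfolding c_M Z_def by (simp add: sum.distrib sum_subtractf algebra_simps)

text \<open>Each side is \<nabla> of \<open>Z\<close> by \<open>c_M_Z\<close>, and \<nabla>
  preserves the symmetry of \<open>Z\<close> in \<open>m\<close>, \<open>j\<close>.\<close>

lemma c_M_sym: "(\<Sum>i\<in>UNIV. c i m l x y * berwald_deriv j i s k x y) - (\<Sum>i\<in>UNIV. c i m k x y * berwald_deriv j i s l x y)
    = (\<Sum>i\<in>UNIV. c i j l x y * berwald_deriv m i s k x y) - (\<Sum>i\<in>UNIV. c i j k x y * berwald_deriv m i s l x y)"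
  unfolding c_M_Z Z_sym[of m] Z_sym[of _ j] by (simp add: sum.distrib)

section \<open>Mean Berwald curvature and Douglas tensor\<close>

definition P :: "'n coord_fun" where
  "P = (\<lambda>x y. \<Sum>m\<in>UNIV. N m m x y)"

definition p :: "'n \<Rightarrow> 'n \<Rightarrow> 'n coord_fun" where
  "p j k = (\<lambda>x y. 1 / (real CARD('n) + 1) * yd j (yd k P) x y)"

definition E :: "'n \<Rightarrow> 'n \<Rightarrow> 'n coord_fun" where "E = spray_cov2 p"

lemma sm_P [simp]: "sm P"
  unfolding P_def by auto

lemma sm_p [simp]: "sm (p j k)"
  unfolding p_def by auto

lemma p_sym: "p j k = p k j"
  by (simp add: p_def yd_commute)

lemma sm_E [simp]: "sm (E j k)"
  unfolding E_def spray_cov2_def by auto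

lemma E_outside [simp]: "\<not> (x \<in> U \<and> y \<noteq> 0) \<Longrightarrow> E j k x y = 0"
  by (simp add: E_def spray_cov2_def)

lemma E_sym: "E j k x y = E k j x y"
  by (simp add: E_def spray_cov2_def p_sym)

lemma p_y: "(\<Sum>k\<in>UNIV. p j k x y * y $ k) = 0"
proof (cases "x \<in> U \<and> y \<noteq> 0")
  case True
  have "hom 1 (N m m)" for m
    using hom_yd[of "spray L m" 1] hom_spray[of m] by (auto simp: numeral_2_eq_2)
  then have "hom 1 P" unfolding P_def by (rule hom_sum)
  then have "hom 0 (yd j P)" by (intro hom_yd) auto
  from euler_yd[OF _ this, of x y] True have "(\<Sum>k\<in>UNIV. y $ k * yd j (yd k P) x y) = 0"
    by (simp add: yd_commute)
  then show ?thesis by (simp add: p_def sum_divide_distrib[symmetric] mult.commute)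
qed (simp add: p_def)

text \<open>Apply the spray derivative to \<open>p_y\<close>; since \<open>y\<close> is parallel,
  the terms from its derivative and from \<open>N\<close> acting on the index \<open>k\<close>
  cancel.\<close>

lemma E_y:
  assumes "x \<in> U" "y \<noteq> 0"
  shows "(\<Sum>k\<in>UNIV. E j k x y * y $ k) = 0"
proof -
  have "(\<lambda>x y. \<Sum>k\<in>UNIV. p j k x y * y $ k) = (\<lambda>x y. 0)"
    using p_y by (simp add: fun_eq_iff)
  from fun_cong[OF fun_cong[OF arg_cong[OF this, of spray_deriv], of x], of y]
  have 1: "(\<Sum>k\<in>UNIV. spray_deriv (p j k) x y * y $ k) = 2 * (\<Sum>k\<in>UNIV. p j k x y * spray L k x y)"
    using assms by (simp add: spray_deriv_y sum.distrib sum_negf sum_distrib_left mult_ac)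
  have "(\<Sum>k\<in>UNIV. (\<Sum>r\<in>UNIV. p r k x y * N r j x y) * y $ k) = (\<Sum>r\<in>UNIV. N r j x y * (\<Sum>k\<in>UNIV. p r k x y * y $ k))"
    unfolding sum_distrib_left sum_distrib_right by (subst sum.swap) (simp add: mult_ac)
  then have 2: "(\<Sum>k\<in>UNIV. (\<Sum>r\<in>UNIV. p r k x y * N r j x y) * y $ k) = 0"
    by (simp add: p_y)
  have eu: "(\<Sum>k\<in>UNIV. y $ k * N r k x y) = 2 * spray L r x y" for r
    using euler_yd[OF _ hom_spray[of r], of x y] assms by simp
  have "(\<Sum>k\<in>UNIV. (\<Sum>r\<in>UNIV. p j r x y * N r k x y) * y $ k) = (\<Sum>r\<in>UNIV. p j r x y * (\<Sum>k\<in>UNIV. y $ k * N r k x y))"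
    unfolding sum_distrib_left sum_distrib_right by (subst sum.swap) (simp add: mult_ac)
  then have 3: "(\<Sum>k\<in>UNIV. (\<Sum>r\<in>UNIV. p j r x y * N r k x y) * y $ k) = 2 * (\<Sum>r\<in>UNIV. p j r x y * spray L r x y)"
    unfolding eu by (simp add: sum_distrib_left mult.left_commute)
  show ?thesis
    unfolding E_def spray_cov2_def left_diff_distrib sum_subtractf 1 2 3 by simp
qed

definition p3 :: "'n \<Rightarrow> 'n \<Rightarrow> 'n \<Rightarrow> 'n coord_fun" where
  "p3 j k l = (\<lambda>x y. 1 / (real CARD('n) + 1) * yd j (yd k (yd l P)) x y)"

lemma sm_p3 [simp]: "sm (p3 j k l)"
  unfolding p3_def by auto

text \<open>The Douglas tensor with the third derivative of \<open>P * y^i\<close> expanded by the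
  product rule, so that each summand matches a rule for \<open>spray_cov\<close>.\<close>

definition D :: "'n \<Rightarrow> 'n \<Rightarrow> 'n \<Rightarrow> 'n \<Rightarrow> 'n coord_fun" where
  "D j i k l = (\<lambda>x y. B j i k l x y - (p3 j k l x y * y $ i + ((if l = i then 1 else 0) * p j k x y
    + ((if j = i then 1 else 0) * p k l x y + (if k = i then 1 else 0) * p l j x y))))"

lemma sm_D [simp]: "sm (D j i k l)"
  unfolding D_def by (intro sm_diff sm_add sm_mult sm_p3 sm_p sm_y sm_yd sm_G sm_const)

lemma D_eq:
  assumes "x \<in> U" "y \<noteq> 0"
  shows "D j i k l x y = douglas L j i k l x y"
proof -
  let ?f = "\<lambda>x y. (\<Sum>m\<in>UNIV. spray1 L m m x y) * y $ i"
  have sm1: "sm (spray1 L m m)" for m unfolding spray1_def using sm_spray by auto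
  have "yd l ?f = yd l (\<lambda>x y. P x y * y $ i)"
    by (rule yd_cong) (use sm1 in \<open>auto simp: P_def spray1_def yd_eq\<close>)
  then have "dy j (dy k (dy l ?f)) x y = yd j (yd k (yd l (\<lambda>x y. P x y * y $ i))) x y"
    using assms sm1 by (subst yd3_eq[symmetric]) (auto intro!: sm_mult sm_sum)
  moreover have "one x y = 1" using assms by (simp add: one_def)
  ultimately show ?thesis
    using assms by (simp add: D_def douglas_def berwald_def yd3_eq sm_spray p_def p3_def yd_commute
        add_divide_distrib algebra_simps)
qed

lemma N_y: "x \<in> U \<Longrightarrow> y \<noteq> 0 \<Longrightarrow> (\<Sum>m\<in>UNIV. N r m x y * y $ m) = 2 * spray L r x y"
  using euler_yd[OF _ hom_spray[of r], of x y] by (simp add: mult.commute)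

lemma spray2_y:
  assumes "x \<in> U" "y \<noteq> 0"
  shows "(\<Sum>m\<in>UNIV. spray2 L i r m x y * y $ m) = N i r x y"
proof -
  have "hom 1 (N i r)"
    using hom_yd[of "spray L i" 1] hom_spray[of i] by (auto simp: numeral_2_eq_2)
  from euler_yd[OF _ this assms] have "(\<Sum>m\<in>UNIV. yd r (yd m (spray L i)) x y * y $ m) = N i r x y"
    by (simp add: yd_commute mult.commute)
  then show ?thesis using assms by (simp add: spray2_def yd2_eq sm_spray)
qed

text \<open>Euler's identity reduces the contractions of \<open>spray1\<close> and
  \<open>spray2\<close> with \<open>y\<close> to \<open>2 * spray\<close> and \<open>N\<close>; this
  links the GDW equation to \<open>spray_cov\<close>.\<close>

lemma hcov_y:
  assumes xy: "x \<in> U" "y \<noteq> 0"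
  shows "(\<Sum>m\<in>UNIV. hcov13 L (douglas L) j i k l m x y * y $ m) = spray_cov D j i k l x y"
proof -
  have sw: "(\<Sum>m\<in>UNIV. (\<Sum>r\<in>UNIV. X r * Y r m) * y $ m) = (\<Sum>r\<in>UNIV. X r * (\<Sum>m\<in>UNIV. Y r m * y $ m))"
    for X :: "'n \<Rightarrow> real" and Y
    unfolding sum_distrib_left sum_distrib_right by (subst sum.swap) (simp add: mult_ac)
  have dD: "dx m (douglas L j i k l) x y = xd m (D j i k l) x y"
    "dy m (douglas L j i k l) x y = yd m (D j i k l) x y" for m
    using xy dx_cong[OF xy sm_D D_eq] dy_cong[OF xy sm_D D_eq] by (simp_all add: xd_eq yd_eq)
  have "spray1 L r m x y = N r m x y" for r m
    using xy by (simp add: spray1_def yd_eq)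
  then have "hdelta L m (douglas L j i k l) x y =
      xd m (D j i k l) x y - (\<Sum>r\<in>UNIV. yd r (D j i k l) x y * N r m x y)" for m
    by (simp add: hdelta_def dD mult.commute)
  then have "(\<Sum>m\<in>UNIV. hdelta L m (douglas L j i k l) x y * y $ m) =
      (\<Sum>m\<in>UNIV. xd m (D j i k l) x y * y $ m) - (\<Sum>r\<in>UNIV. yd r (D j i k l) x y * (2 * spray L r x y))"
    by (simp only: left_diff_distrib sum_subtractf sw N_y[OF xy])
  then have "(\<Sum>m\<in>UNIV. hdelta L m (douglas L j i k l) x y * y $ m) = spray_deriv (D j i k l) x y"
    by (simp add: spray_deriv_def sum_distrib_left mult_ac)
  then show ?thesis
    unfolding hcov13_def spray_cov_def D_eq[OF xy, symmetric] left_diff_distrib distrib_right sum_subtractf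
      sum.distrib sw spray2_y[OF xy] by simp
qed

text \<open>The GDW equation solved for \<nabla> \<open>B\<close>. The deltas and \<open>y\<close>
  pass through \<nabla>, and the part of the Douglas correction along \<open>y $ i\<close> joins
  \<open>T\<close>.\<close>

lemma M_eq:
  assumes xy: "x \<in> U" "y \<noteq> 0"
  shows "berwald_deriv j i k l x y = (T j k l x y + spray_cov3 p3 j k l x y) * y $ i
    + (if l = i then 1 else 0) * E j k x y + (if j = i then 1 else 0) * E k l x y
    + (if k = i then 1 else 0) * E l j x y"
proof -
  have "spray_cov D j i k l x y = spray_cov B j i k l x y
      - (spray_cov (\<lambda>j i k l x y. p3 j k l x y * y $ i) j i k l x y
      + (spray_cov (\<lambda>j i k l x y. (if l = i then 1 else 0) * p j k x y) j i k l x y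
      + (spray_cov (\<lambda>j i k l x y. (if j = i then 1 else 0) * p k l x y) j i k l x y
      + spray_cov (\<lambda>j i k l x y. (if k = i then 1 else 0) * p l j x y) j i k l x y)))"
    unfolding D_def[abs_def]
    by (subst spray_cov_diff spray_cov_add; (intro sm_add sm_mult sm_p3 sm_p sm_y sm_yd sm_G sm_const)?)+ (rule refl)
  then have "spray_cov D j i k l x y = spray_cov B j i k l x y - (spray_cov3 p3 j k l x y * y $ i
      + ((if l = i then 1 else 0) * E j k x y
      + ((if j = i then 1 else 0) * E k l x y + (if k = i then 1 else 0) * E l j x y)))"
    unfolding spray_cov_y[OF sm_p3 hom_spray xy] spray_cov_delta_l[of p, OF sm_p]
      spray_cov_delta_j[of p, OF sm_p] spray_cov_delta_k[of p, OF sm_p] E_def .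
  then show ?thesis
    using gdw[OF xy, of j i k l] unfolding hcov_y[OF xy] berwald_deriv_def by (simp add: algebra_simps)
qed

section \<open>Passage to the algebra at one point\<close>

lemma sum_yd_Q_y: "x \<in> U \<Longrightarrow> y \<noteq> 0 \<Longrightarrow> (\<Sum>i\<in>UNIV. yd i Q x y * y $ i) = 2 * Q x y"
  using euler_yd[OF _ hom_Q, of x y] by (simp add: mult.commute)

text \<open>Positive definiteness applied to \<open>u = y\<close>, where the quadratic form equals
  \<open>Q\<close>.\<close>

lemma Q_nonzero:
  assumes "x \<in> U" "y \<noteq> 0"
  shows "Q x y \<noteq> 0"
proof -
  have "(\<Sum>i\<in>UNIV. \<Sum>j\<in>UNIV. fund_tensor L i j x y * y $ i * y $ j)
      = (\<Sum>i\<in>UNIV. 1/2 * ((\<Sum>j\<in>UNIV. q i j x y * y $ j) * y $ i))"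
    using assms by (simp add: fund_eq sum_distrib_left sum_distrib_right mult_ac)
  also have "\<dots> = Q x y"
    using assms by (simp add: q_y sum_distrib_left[symmetric] sum_divide_distrib[symmetric] sum_yd_Q_y)
  finally show ?thesis using pos[OF assms assms(2)] by simp
qed

definition qi :: "'n \<Rightarrow> 'n \<Rightarrow> 'n coord_fun" where
  "qi i j = (\<lambda>x y. 1/2 * fund_tensor_inv L i j x y)"

lemma sm_qi [simp]: "sm (qi i j)"
  unfolding qi_def using sm_fund_inv by auto

lemma qi_q:
  assumes "x \<in> U" "y \<noteq> 0"
  shows "(\<Sum>j\<in>UNIV. qi i j x y * q j k x y) = (if i = k then 1 else 0)"
  using fund_mult_inv(2)[OF assms, of i k] assms by (simp add: fund_eq qi_def)

lemma contraction_at: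
  assumes xy: "x \<in> U" "y \<noteq> 0"
  shows "metric_contraction (\<lambda>i j. q i j x y) (\<lambda>i j. qi i j x y) (\<lambda>i. y $ i) (\<lambda>i. yd i Q x y) (2 * Q x y)"
proof
  show "q i j x y = q j i x y" for i j by (simp add: yd_commute)
  show "qi i j x y = qi j i x y" for i j using fund_inv_sym[OF xy] by (simp add: qi_def)
qed (use Q_nonzero[OF xy] in \<open>simp_all add: qi_q[OF xy] q_y[OF xy] sum_yd_Q_y[OF xy]\<close>)

lemma c_y:
  assumes "x \<in> U" "y \<noteq> 0"
  shows "(\<Sum>k\<in>UNIV. c i j k x y * y $ k) = 0"
proof -
  have "hom 0 (q i j)" by (intro hom_yd[of "yd j Q"]) (use hom_yd_Q in auto)
  from euler_yd[OF _ this assms] show ?thesis by (simp add: yd_commute mult.commute)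
qed

lemma algebra_at:
  assumes xy: "x \<in> U" "y \<noteq> 0"
  shows "gdw_algebra (\<lambda>i j. q i j x y) (\<lambda>i j. qi i j x y) (\<lambda>i. y $ i) (\<lambda>i. yd i Q x y) (2 * Q x y)
    (\<lambda>j k. E j k x y) (\<lambda>i j k. c i j k x y) (\<lambda>j k l. T j k l x y + spray_cov3 p3 j k l x y)
    (\<lambda>j i k l. berwald_deriv j i k l x y)"
proof -
  interpret metric_contraction "\<lambda>i j. q i j x y" "\<lambda>i j. qi i j x y" "\<lambda>i. y $ i" "\<lambda>i. yd i Q x y" "2 * Q x y"
    by (rule contraction_at[OF xy])
  show ?thesis
  proof
    show "E j k x y = E k j x y" for j k by (rule E_sym)
    show "(\<Sum>k\<in>UNIV. E j k x y * y $ k) = 0" for j by (rule E_y[OF xy])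
    show "(\<Sum>i\<in>UNIV. yd i Q x y * berwald_deriv j i k l x y) = 0" for j k l
    proof -
      \<comment> \<open>The lowered \<open>y\<close> is parallel and \<open>Q_B\<close> kills its
        contraction with \<open>B\<close>, so the Leibniz rule gives 0.\<close>
      have "spray_deriv (yd i Q) x y = (\<Sum>r\<in>UNIV. N r i x y * yd r Q x y)" for i
        unfolding spray_deriv_yd_Q xd_Q ..
      then show ?thesis
        using contract_berwald_deriv[of "\<lambda>i. yd i Q" x y j k l] by (simp add: Q_B del: spray_deriv_sum spray_deriv_mult)
    qed
    show "(\<Sum>i\<in>UNIV. q m i x y * berwald_deriv j i k l x y) = (\<Sum>i\<in>UNIV. q l i x y * berwald_deriv j i k m x y)"
      for m j k l by (rule q_M_sym)
    show "(\<Sum>k\<in>UNIV. c i j k x y * y $ k) = 0" for i j by (rule c_y[OF xy])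
    show "c i j k x y = c j i k x y" "c i j k x y = c i k j x y" for i j k by (simp_all add: yd_commute)
    show "(\<Sum>i\<in>UNIV. c i m l x y * berwald_deriv j i s k x y) - (\<Sum>i\<in>UNIV. c i m k x y * berwald_deriv j i s l x y)
    = (\<Sum>i\<in>UNIV. c i j l x y * berwald_deriv m i s k x y) - (\<Sum>i\<in>UNIV. c i j k x y * berwald_deriv m i s l x y)"
      for m l j s k by (rule c_M_sym)
  qed (use M_eq[OF xy] dim in auto)
qed

text \<open>The factor of \<open>gdw_algebra\<close> as a function on the slit tangent bundle; the
  annihilation lemmas differentiate products containing it and need it smooth.\<close>

definition lam :: "'n coord_fun" where
  "lam = (\<lambda>x y. (\<Sum>j\<in>UNIV. \<Sum>k\<in>UNIV. qi j k x y * E j k x y) / (real CARD('n) - 1))"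

text \<open>Up to a factor 2, the mean Cartan torsion.\<close>

definition I :: "'n \<Rightarrow> 'n coord_fun" where
  "I l = (\<lambda>x y. \<Sum>j\<in>UNIV. \<Sum>k\<in>UNIV. qi j k x y * c j k l x y)"

lemma sm_lam [simp]: "sm lam"
  unfolding lam_def by (intro sm_cdivide sm_sum sm_mult sm_const sm_qi sm_E)

lemma sm_I [simp]: "sm (I l)"
  unfolding I_def by (intro sm_sum sm_mult sm_const sm_qi sm_yd sm_Q)

lemma lam_I: "lam x y * I l x y = 0"
proof (cases "x \<in> U \<and> y \<noteq> 0")
  case True
  then interpret A: gdw_algebra "\<lambda>i j. q i j x y" "\<lambda>i j. qi i j x y" "\<lambda>i. y $ i" "\<lambda>i. yd i Q x y" "2 * Q x y"
    "\<lambda>j k. E j k x y" "\<lambda>i j k. c i j k x y" "\<lambda>j k l. T j k l x y + spray_cov3 p3 j k l x y"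
    "\<lambda>j i k l. berwald_deriv j i k l x y"
    by (intro algebra_at) auto
  show ?thesis using A.lam_C[of l] by (simp add: A.lam_def A.tr_def lam_def I_def)
qed (simp add: I_def)

text \<open>Trace of \<open>xd_q\<close>. The left side is the \<open>x\<close>-derivative of
  \<open>ln (det q)\<close>, and each of the two connection terms contributes
  \<open>yd j P\<close>.\<close>

lemma contract_xd_q: "(\<Sum>k\<in>UNIV. \<Sum>l\<in>UNIV. qi k l x y * xd j (q k l) x y)
    = 2 * yd j P x y + (\<Sum>r\<in>UNIV. N r j x y * I r x y)"
proof (cases "x \<in> U \<and> y \<noteq> 0")
  case True
  then interpret A: metric_contraction "\<lambda>i j. q i j x y" "\<lambda>i j. qi i j x y" "\<lambda>i. y $ i" "\<lambda>i. yd i Q x y" "2 * Q x y"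
    by (intro contraction_at) auto
  have "(\<Sum>k\<in>UNIV. \<Sum>l\<in>UNIV. qi k l x y * xd j (q k l) x y) = A.tr (\<lambda>k l. \<Sum>r\<in>UNIV.
      q r l x y * yd j (yd k (spray L r)) x y + q r k x y * yd j (yd l (spray L r)) x y + N r j x y * c k l r x y)"
    unfolding A.tr_def xd_q by (simp add: yd_commute mult.commute)
  also have "\<dots> = (\<Sum>r\<in>UNIV. A.tr (\<lambda>l k. q r l x y * yd j (yd k (spray L r)) x y)
      + A.tr (\<lambda>k l. q r k x y * yd j (yd l (spray L r)) x y) + N r j x y * A.tr (\<lambda>k l. c k l r x y))"
    unfolding A.tr_sum A.tr_add A.tr_cmult A.tr_transpose[of "\<lambda>k l. q _ k x y * yd j (yd l (spray L _)) x y"] ..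
  also have "\<dots> = 2 * (\<Sum>r\<in>UNIV. yd j (yd r (spray L r)) x y) + (\<Sum>r\<in>UNIV. N r j x y * I r x y)"
    by (simp add: A.tr_vec sum.distrib sum_distrib_left) (simp add: A.tr_def I_def)
  finally show ?thesis by (simp add: P_def)
qed simp

lemma qi_variation:
  "x \<in> U \<Longrightarrow> y \<noteq> 0 \<Longrightarrow> (\<Sum>k\<in>UNIV. xd j (qi l k) x y * q k m x y + qi l k x y * xd j (q k m) x y) = 0"
  "x \<in> U \<Longrightarrow> y \<noteq> 0 \<Longrightarrow> (\<Sum>k\<in>UNIV. yd j (qi l k) x y * q k m x y + qi l k x y * yd j (q k m) x y) = 0"
  using xd_cong[of "\<lambda>x y. \<Sum>k\<in>UNIV. qi l k x y * q k m x y" "\<lambda>x y. if l = m then 1 else 0" j]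
    yd_cong[of "\<lambda>x y. \<Sum>k\<in>UNIV. qi l k x y * q k m x y" "\<lambda>x y. if l = m then 1 else 0" j] qi_q
  by (simp_all add: fun_eq_iff)

text \<open>Both sides are mixed derivatives of \<open>ln (det q)\<close>.\<close>

lemma yd_contract_xd_q:
  "yd s (\<lambda>x y. \<Sum>k\<in>UNIV. \<Sum>l\<in>UNIV. qi k l x y * xd j (q k l) x y) = xd j (I s)"
proof (intro ext)
  fix x y
  show "yd s (\<lambda>x y. \<Sum>k\<in>UNIV. \<Sum>l\<in>UNIV. qi k l x y * xd j (q k l) x y) x y = xd j (I s) x y"
  proof (cases "x \<in> U \<and> y \<noteq> 0")
    case True
    then interpret A: metric_contraction "\<lambda>i j. q i j x y" "\<lambda>i j. qi i j x y" "\<lambda>i. y $ i" "\<lambda>i. yd i Q x y" "2 * Q x y"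
      by (intro contraction_at) auto
    \<comment> \<open>These are the terms with a differentiated inverse; the remaining ones agree
      because mixed partial derivatives commute.\<close>
    have "(\<Sum>k\<in>UNIV. \<Sum>l\<in>UNIV. yd s (qi k l) x y * xd j (q k l) x y) =
        (\<Sum>k\<in>UNIV. \<Sum>l\<in>UNIV. xd j (qi k l) x y * yd s (q k l) x y)"
      using True by (intro A.inverse_variation_symmetric qi_variation) auto
    then show ?thesis
      by (simp add: I_def yd_xd yd_commute[of _ s] sum.distrib)
  qed simp
qed

text \<open>The vertical derivative of \<open>contract_xd_q\<close> expresses
  \<open>yd s (yd j P)\<close> through \<open>I\<close> and its first derivatives, and
  \<open>lam\<close> annihilates all of these.\<close>

lemma lam_p: "lam x y * p j s x y = 0"
proof -
  have fn: "(\<lambda>x y. lam x y * I l x y) = (\<lambda>x y. 0)" for l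
    using lam_I by (simp add: fun_eq_iff)
  have "(\<lambda>x y. \<Sum>k\<in>UNIV. \<Sum>l\<in>UNIV. qi k l x y * xd j (q k l) x y) =
      (\<lambda>x y. 2 * yd j P x y + (\<Sum>r\<in>UNIV. N r j x y * I r x y))"
    by (simp only: contract_xd_q)
  from arg_cong[OF this, of "yd s"]
  have "xd j (I s) x y = 2 * yd s (yd j P) x y + (\<Sum>r\<in>UNIV. yd s (N r j) x y * I r x y + N r j x y * yd s (I r) x y)"
    unfolding yd_contract_xd_q by simp
  then have "lam x y * xd j (I s) x y = 2 * (lam x y * yd s (yd j P) x y)
      + (\<Sum>r\<in>UNIV. yd s (N r j) x y * (lam x y * I r x y) + N r j x y * (lam x y * yd s (I r) x y))"
    by (simp add: distrib_left sum_distrib_left mult_ac)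
  then have "lam x y * yd s (yd j P) x y = 0"
    using xd_annihilated[OF sm_lam sm_I fn] yd_annihilated[OF sm_lam sm_I fn] lam_I by simp
  then show ?thesis by (auto simp: p_def yd_commute)
qed

text \<open>\<open>lam\<close> annihilates \<open>p\<close>, hence also its spray derivative and all
  terms of \<nabla> \<open>p\<close>.\<close>

lemma lam_E: "lam x y * E j k x y = 0"
proof -
  have fn: "(\<lambda>x y. lam x y * p j s x y) = (\<lambda>x y. 0)" for j s
    using lam_p by (simp add: fun_eq_iff)
  have "lam x y * E j k x y = lam x y * spray_deriv (p j k) x y
      - (\<Sum>r\<in>UNIV. (lam x y * p r k x y) * N r j x y) - (\<Sum>r\<in>UNIV. (lam x y * p j r x y) * N r k x y)"
    by (simp add: E_def spray_cov2_def right_diff_distrib sum_distrib_left mult.assoc)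
  then show ?thesis
    using spray_deriv_annihilated[OF sm_lam sm_p fn] lam_p by simp
qed

text \<open>Since \<open>lam\<close> is itself a multiple of the trace of \<open>E\<close>, the
  square \<open>lam * lam\<close> is built from \<open>lam * E = 0\<close>.\<close>

lemma lam_0: "lam x y = 0"
proof -
  have "lam x y * lam x y = lam x y * ((\<Sum>j\<in>UNIV. \<Sum>k\<in>UNIV. qi j k x y * E j k x y) / (real CARD('n) - 1))"
    by (subst (2) lam_def) (rule refl)
  also have "\<dots> = (\<Sum>j\<in>UNIV. \<Sum>k\<in>UNIV. qi j k x y * (lam x y * E j k x y)) / (real CARD('n) - 1)"
    by (simp add: sum_distrib_left mult_ac)
  finally show ?thesis by (simp add: lam_E)
qed

lemma berwald_deriv_0: "berwald_deriv j i k l = (\<lambda>x y. 0)"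
proof (intro ext)
  fix x y
  show "berwald_deriv j i k l x y = 0"
  proof (cases "x \<in> U \<and> y \<noteq> 0")
    case True
    then interpret A: gdw_algebra "\<lambda>i j. q i j x y" "\<lambda>i j. qi i j x y" "\<lambda>i. y $ i" "\<lambda>i. yd i Q x y" "2 * Q x y"
      "\<lambda>j k. E j k x y" "\<lambda>i j k. c i j k x y" "\<lambda>j k l. T j k l x y + spray_cov3 p3 j k l x y"
      "\<lambda>j i k l. berwald_deriv j i k l x y"
      by (intro algebra_at) auto
    have "A.lam = lam x y" by (simp add: A.lam_def A.tr_def lam_def)
    then show ?thesis using lam_0 A.M_eq_0 by simp
  qed (simp add: berwald_deriv_def spray_cov_def)
qed

section \<open>From \<nabla> \<open>B = 0\<close> to quadratic curvature\<close>

lemma riemann_eq: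
  assumes xy: "x \<in> U" "y \<noteq> 0"
  shows "riemann L i k x y = spray_riemann i k x y"
proof -
  have 1: "xd j (yd k (spray L i)) x y = dx j (dy k (spray L i)) x y" for j
    using xd_cong[of "yd k (spray L i)" "dy k (spray L i)" j] xy
    by (simp add: xd_def[of j "dy k (spray L i)"] yd_eq[of _ _ k] sm_spray)
  have 2: "yd j (yd k (spray L i)) x y = dy j (dy k (spray L i)) x y" for j
    using xy by (simp add: yd2_eq sm_spray)
  have 3: "yd j (spray L i) x y = dy j (spray L i) x y" for i j
    using xy by (simp add: yd_eq)
  show ?thesis
    unfolding riemann_def spray_riemann_def spray_deriv_def 1 2 3 xd_eq[OF xy, of k "spray L i"] by simp
qed

lemma sm_riemann: "sm (spray_riemann i k)"
  unfolding spray_riemann_def by (intro sm_diff sm_mult sm_sum sm_const sm_xd sm_yd sm_spray_deriv sm_G)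

lemma hom_riemann: "hom 2 (spray_riemann i k)"
proof -
  have N: "hom 1 (N i j)" for i j
    using hom_yd[of "spray L i" 1 j] hom_spray[of i] by (simp add: numeral_2_eq_2)
  have "hom (1 + 1) (\<lambda>x y. y $ j * xd j (N i k) x y)" for j
    by (rule hom_mult[OF hom_y hom_xd[OF _ N]]) simp
  moreover have "hom (2 + 0) (\<lambda>x y. spray L j x y * yd j (N i k) x y)" for j
    by (rule hom_mult[OF hom_spray hom_yd]) (use N in auto)
  moreover have "hom (1 + 1) (\<lambda>x y. N i r x y * N r k x y)" for r
    by (rule hom_mult[OF N N])
  moreover have "hom 2 (xd k (spray L i))"
    by (intro hom_xd hom_spray) simp
  ultimately show ?thesis
    unfolding spray_riemann_def spray_deriv_def one_add_one add_0_right
    by (intro hom_diff hom_cmult hom_sum)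
qed

text \<open>The second vertical derivatives of the curvature have zero vertical derivative, so they
  are constant on the punctured fibre; Euler's identity applied twice recovers the curvature from
  them.\<close>

lemma riemann_quadratic:
  assumes x: "x \<in> U"
  shows "\<exists>b. \<forall>y. y \<noteq> 0 \<longrightarrow> riemann L i k x y = (\<Sum>j\<in>UNIV. \<Sum>l\<in>UNIV. b j l * y $ j * y $ l)"
proof -
  define W where "W j l = yd j (yd l (spray_riemann i k))" for j l
  have smW: "sm (W j l)" for j l unfolding W_def using sm_riemann by auto
  have "yd r (W j l) x y = 0" for r j l y
    unfolding W_def yd3_riemann by (simp add: berwald_deriv_0)
  then have der: "((\<lambda>y. W j l x y) has_derivative (\<lambda>v. 0)) (at y)" if "y \<noteq> 0" for j l y
  proof -
    have "((\<lambda>y. (x, y)) has_derivative (\<lambda>v. (0, v))) (at y)"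
      by (intro derivative_intros)
    from has_derivative_compose[OF this smooth_expr_has_derivative[OF smW x that]]
    have "((\<lambda>y. W j l x y) has_derivative (\<lambda>v. dir_deriv (0, v) (W j l) x y)) (at y)" by simp
    moreover have "dir_deriv (0, v) (W j l) x y = 0" for v
      unfolding dir_deriv_vertical[OF smW x that]
      using \<open>\<And>r j l y. yd r (W j l) x y = 0\<close> x that by (simp add: yd_eq[symmetric])
    ultimately show ?thesis by simp
  qed
  \<comment> \<open>\<open>dim\<close> supplies connectedness of the punctured fibre, which fails in
    dimension 1.\<close>
  have conn: "connected (- {0 :: real ^ 'n})"
    using dim by (intro path_connected_imp_connected path_connected_punctured_universe) simp
  \<comment> \<open>The constants are read off at the vector with all entries 1, a nonzero base
    point; Euler's identity in degrees 2 and 1 accounts for the factor 1/2.\<close>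
  define b where "b j l = 1/2 * W j l x 1" for j l
  have nz: "(1 :: real ^ 'n) \<noteq> 0" by (simp add: vec_eq_iff)
  have W_const: "W j l x y = 2 * b j l" if "y \<noteq> 0" for j l y
    using has_derivative_zero_unique_connected[OF _ conn, of "\<lambda>y. W j l x y" y 1] der that nz
    by (auto simp: b_def)
  have "riemann L i k x y = (\<Sum>j\<in>UNIV. \<Sum>l\<in>UNIV. b j l * y $ j * y $ l)" if y: "y \<noteq> 0" for y
  proof -
    have "(\<Sum>j\<in>UNIV. y $ j * W j l x y) = yd l (spray_riemann i k) x y" for l
      using euler_yd[OF _ hom_yd[of "spray_riemann i k" 1 l] x y] sm_riemann hom_riemann
      by (simp add: W_def numeral_2_eq_2)
    then have "2 * spray_riemann i k x y = (\<Sum>l\<in>UNIV. y $ l * (\<Sum>j\<in>UNIV. y $ j * W j l x y))"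
      using euler_yd[OF sm_riemann hom_riemann x y] by simp
    also have "\<dots> = (\<Sum>l\<in>UNIV. \<Sum>j\<in>UNIV. 2 * (b j l * y $ j * y $ l))"
      using y by (simp add: W_const sum_distrib_left mult_ac)
    also have "\<dots> = 2 * (\<Sum>j\<in>UNIV. \<Sum>l\<in>UNIV. b j l * y $ j * y $ l)"
      by (subst sum.swap) (simp add: sum_distrib_left)
    finally show ?thesis using riemann_eq[OF x y] by simp
  qed
  then show ?thesis by blast
qed

end

section \<open>Reduction to a chart\<close>

lemma chart_inv_inverse:
  assumes "x \<in> snd c ` fst c"
  shows "chart_inv c x \<in> fst c" "snd c (chart_inv c x) = x"
  using assms unfolding chart_inv_def by (auto simp: inv_into_into f_inv_into_f)

lemma is_chart_inj_on: "is_chart X c \<Longrightarrow> inj_on (snd c) (fst c)"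
  unfolding is_chart_def
  by (metis homeomorphic_imp_injective_map inf.absorb_iff2 openin_subset topspace_subtopology)

lemma chart_inv_left_inverse: "is_chart X c \<Longrightarrow> p \<in> fst c \<Longrightarrow> chart_inv c (snd c p) = p"
  unfolding chart_inv_def by (intro inv_into_f_f is_chart_inj_on)

lemma open_chart_overlap:
  assumes "is_chart X c" "is_chart X c'"
  shows "open (snd c ` (fst c \<inter> fst c'))"
proof -
  have "openin (subtopology X (fst c)) (fst c \<inter> fst c')"
    using assms by (auto simp: is_chart_def openin_subtopology_Int2)
  then have "openin (top_of_set (snd c ` fst c)) (snd c ` (fst c \<inter> fst c'))"
    using assms(1) unfolding is_chart_def
    by (meson homeomorphic_imp_open_map open_map_def)
  then show ?thesis using assms(1) unfolding is_chart_def by (meson openin_open_trans)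
qed

text \<open>Cocycle rule: on the image of the overlap of \<open>c\<close> and \<open>c1\<close>, an
  open set, the transition to \<open>c2\<close> factors through \<open>c1\<close>, and the chain
  rule applies.\<close>

lemma transition_compose_derivative:
  assumes atlas: "smooth_atlas X \<A>" and c: "c \<in> \<A>" "c1 \<in> \<A>" "c2 \<in> \<A>"
    and p: "p \<in> fst c" "p \<in> fst c1" "p \<in> fst c2"
  shows "frechet_derivative (transition c c2) (at (snd c p)) y =
    frechet_derivative (transition c1 c2) (at (snd c1 p)) (frechet_derivative (transition c c1) (at (snd c p)) y)"
proof -
  have ch: "is_chart X a" if "a \<in> \<A>" for a using atlas that by (simp add: smooth_atlas_def)
  have diff: "transition a b differentiable (at (snd a p))" if "a \<in> \<A>" "b \<in> \<A>" "p \<in> fst a" "p \<in> fst b" for a b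
    using atlas that by (intro smooth_on_differentiable[of "snd a ` (fst a \<inter> fst b)"]) (auto simp: smooth_atlas_def)
  have tr: "transition c c1 (snd c p) = snd c1 p"
    using chart_inv_left_inverse[OF ch p(1)] c by (simp add: transition_def)
  let ?S = "snd c ` (fst c \<inter> fst c1)"
  have "frechet_derivative (transition c1 c2 \<circ> transition c c1) (at (snd c p)) =
      frechet_derivative (transition c c2) (at (snd c p))"
  proof (rule frechet_derivative_transform_within_open)
    show "transition c1 c2 \<circ> transition c c1 differentiable at (snd c p)"
      by (intro differentiable_chain_at diff) (use diff c p tr in auto)
    show "open ?S" using open_chart_overlap ch c by blast
    show "(transition c1 c2 \<circ> transition c c1) x = transition c c2 x" if "x \<in> ?S" for x
      using that chart_inv_left_inverse[OF ch[OF c(1)]] chart_inv_left_inverse[OF ch[OF c(2)]]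
      by (auto simp: transition_def)
  qed (use p in auto)
  moreover have "frechet_derivative (transition c1 c2 \<circ> transition c c1) (at (snd c p)) =
      frechet_derivative (transition c1 c2) (at (snd c1 p)) \<circ> frechet_derivative (transition c c1) (at (snd c p))"
    using frechet_derivative_compose[of "transition c c1" "snd c p" "transition c1 c2"] diff c p tr by simp
  ultimately show ?thesis by (metis comp_apply)
qed

lemma tangent_of_tangent_space:
  assumes atlas: "smooth_atlas X \<A>" and c: "c \<in> \<A>" and p: "p \<in> fst c"
  shows "tangent_of \<A> c p y \<in> tangent_space \<A> p"
  unfolding tangent_space_def mem_Collect_eq
proof (intro conjI ballI impI allI)
  fix c1 c2
  assume "c1 \<in> \<A>" "c2 \<in> \<A>" "p \<in> fst c1" "p \<in> fst c2"
  then show "tangent_of \<A> c p y c2 =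
      frechet_derivative (transition c1 c2) (at (snd c1 p)) (tangent_of \<A> c p y c1)"
    using transition_compose_derivative[OF atlas c _ _ p, of c1 c2 y] by (simp add: tangent_of_def)
qed (auto simp: tangent_of_def)

lemma tangent_of_scaleR:
  assumes atlas: "smooth_atlas X \<A>" and c: "c \<in> \<A>" and p: "p \<in> fst c"
  shows "tangent_of \<A> c p (a *\<^sub>R y) = (\<lambda>c'. a *\<^sub>R tangent_of \<A> c p y c')"
proof
  fix c'
  show "tangent_of \<A> c p (a *\<^sub>R y) c' = a *\<^sub>R tangent_of \<A> c p y c'"
  proof (cases "c' \<in> \<A> \<and> p \<in> fst c'")
    case True
    then have "transition c c' differentiable (at (snd c p))"
      using atlas c p by (intro smooth_on_differentiable[of "snd c ` (fst c \<inter> fst c')"]) (auto simp: smooth_atlas_def)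
    then show ?thesis
      using True linear_cmul[OF linear_frechet_derivative] by (simp add: tangent_of_def)
  qed (auto simp: tangent_of_def)
qed

text \<open>Homogeneity of \<open>F\<close> carries over because \<open>tangent_of\<close> is linear
  in the components.\<close>

lemma coord_expr_scaleR:
  assumes "smooth_atlas X \<A>" "finsler_metric X \<A> F" "c \<in> \<A>" "x \<in> snd c ` fst c" "a > 0"
  shows "coord_expr \<A> F c x (a *\<^sub>R y) = a * coord_expr \<A> F c x y"
proof -
  note p = chart_inv_inverse(1)[OF assms(4)]
  have "chart_inv c x \<in> topspace X"
    using assms(1,3) p by (auto simp: smooth_atlas_def)
  then show ?thesis
    using assms p tangent_of_tangent_space[OF assms(1,3) p, of y]
    by (auto simp: coord_expr_def tangent_of_scaleR finsler_metric_def)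
qed

theorem theorem1p3:
  fixes X :: "'a topology"
    and \<A> :: "('a, 'n::finite) chart set"
    and F :: "'a \<Rightarrow> ('a, 'n) tangent_vector \<Rightarrow> real"
  assumes "smooth_manifold X \<A>"
    and "CARD('n) > 2"
    and "finsler_metric X \<A> F"
    and "\<not> riemannian \<A> F"
    and "GDW \<A> F"
    and "landsberg_vanishes \<A> F"
  shows "R_quadratic \<A> F"
  unfolding R_quadratic_def
proof (intro ballI allI)
  fix c x i k
  assume c: "c \<in> \<A>" and x: "x \<in> snd c ` fst c"
  have atlas: "smooth_atlas X \<A>" using assms(1) by (simp add: smooth_manifold_def)
  obtain T where T: "\<And>c x y i j k l. c \<in> \<A> \<Longrightarrow> x \<in> snd c ` fst c \<Longrightarrow> y \<noteq> 0 \<Longrightarrow>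
      (\<Sum>m\<in>UNIV. hcov13 (coord_expr \<A> F c) (douglas (coord_expr \<A> F c)) j i k l m x y * y $ m)
        = T c j k l x y * y $ i"
    using assms(5) unfolding GDW_def by blast
  interpret open_region "snd c ` fst c"
    using atlas c by unfold_locales (auto simp: smooth_atlas_def is_chart_def)
  \<comment> \<open>The geometric hypotheses are stated chart by chart, except homogeneity of
    \<open>F\<close>, which \<open>coord_expr_scaleR\<close> transfers.\<close>
  interpret gdw_landsberg "snd c ` fst c" "coord_expr \<A> F c" "T c"
  proof
    show "smooth_expr (snd c ` fst c) (coord_expr \<A> F c)"
      using assms(3) c by (auto simp: finsler_metric_def smooth_expr_def case_prod_beta')
    show "hom 1 (coord_expr \<A> F c)"
      using coord_expr_scaleR[OF atlas assms(3) c] by (auto simp: hom_def)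
  qed (use assms(2,3,6) c T in \<open>auto simp: finsler_metric_def landsberg_vanishes_def\<close>)
  show "\<exists>q. \<forall>y. y \<noteq> 0 \<longrightarrow> riemann (coord_expr \<A> F c) i k x y = (\<Sum>a\<in>UNIV. \<Sum>b\<in>UNIV. q a b * y $ a * y $ b)"
    by (rule riemann_quadratic[OF x])
qed

end
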